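(* Let $\mu$ be a Meixner probability measure of class $\mathcal{M}_L$ on $\mathbb{R}^2$ such that $\mu$ is not supported by any line of equation $ax+by=c$ with $a^2+b^2>0$. Then: 1. Up to an invertible affine transformation, $\mu$ is a product of two Meixner probability measures of class $\mathcal{M}_L$ on $\mathbb{R}$. That is, there exist an invertible linear transformation $\mathcal{S}:\mathbb{R}^2\to\mathbb{R}^2$, a vector $c=(c_1,c_2)\in\mathbb{R}^2$, and two Meixner probability distributions $\mu_1,\mu_2$ of class $\mathcal{M}_L$ on $\mathbb{R}$ such that the measure $\nu(B):=\mu(\mathcal{S}B+c)$ (for Borel sets $B\subset\mathbb{R}^2$, where $\mathcal{S}B+c:=\{\mathcal{S}(x,y)+c\mid (x,y)\in B\}$) satisfies $\nu=\mu_1\otimes\mu_2$. 2. If $\mu$ is not supported by any finite union of lines of equation $ax+by=c$ with $a^2+b^2>0$, then, up to an invertible affine transformation (in the same sense), $\mu$ is a product of two Meixner probability distributions with infinite support of class $\mathcal{M}_L$ on $\mathbb{R}$.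
   Context: **Meixner measures of class $\mathcal{M}_L$ on $\mathbb{R}^2$.** Let $\mu$ be a probability measure on $\mathbb{R}^2$ with finite moments of all orders. Let $F_n\subset L^2(\mathbb{R}^2,\mu)$ be the space of (classes of) real polynomial functions in $(x,y)$ of degree $\le n$, $G_0:=F_0$, $G_n:=F_n\ominus F_{n-1}$ for $n\ge 1$, $G_{-1}:=\{0\}$. The operators $X,Y$ of multiplication by the coordinates $x,y$, acting on the space $\bigcup_nF_n$ of polynomial functions, map $G_n$ into $G_{n-1}\oplus G_n\oplus G_{n+1}$, so they decompose uniquely as $X=a_x^-+a_x^0+a_x^+$, $Y=a_y^-+a_y^0+a_y^+$, with $a_\cdot^-:G_n\to G_{n-1}$, $a_\cdot^0:G_n\to G_n$, $a_\cdot^+:G_n\to G_{n+1}$ for all $n\ge0$ (annihilation, preservation and creation operators). $\mu$ is a *Meixner distribution of class $\mathcal{M}_L$* on $\mathbb{R}^2$ if the real span of $a_x^-,a_x^0,a_x^+,a_y^-,a_y^0,a_y^+$ and the identity $I$ is closed under the commutator $[A,B]=AB-BA$ (so it is a Lie algebra). **Meixner distributions of class $\mathcal{M}_L$ on $\mathbb{R}$.** For a probability measure on $\mathbb{R}$ with finite moments of all orders let $f_n$ be its monic orthogonal polynomials, with $xf_n=f_{n+1}+\alpha_nf_n+\omega_nf_{n-1}$ (Szegő–Jacobi parameters). The class $\mathcal{M}_L$ consists of: (i) measures with infinite support with $\alpha_n=\alpha n+\alpha_0$ ($n\ge0$), $\omega_n=\beta n^2+(t-\beta)n$ ($n\ge1$),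 for some real $\alpha,\beta,t$, $\beta\ge0$, $t>0$, such that $\alpha\neq0$ or $\alpha=\beta=0$; (ii) measures supported on exactly $k$ points ($k\ge1$ an integer), with $\alpha_n=\alpha n+\alpha_0$ for $0\le n\le k-1$, $\omega_n=\beta n^2+(t-\beta)n$ for $1\le n\le k-1$, where $\alpha\ne0$ and $t=-\beta(k-1)$ (with $t>0$ if $k\ge2$); these are the affine images of non-symmetric binomial distributions. *)

theory Defs
  imports "HOL-Probability.Probability" "HOL-Computational_Algebra.Polynomial"
    "HOL-Library.Extended_Nat"
begin

section \<open>Meixner measures of class M_L on the plane\<close>

definition moments2 :: "(real \<times> real) measure \<Rightarrow> bool" where
  "moments2 \<mu> \<longleftrightarrow> (\<forall>i j. integrable \<mu> (\<lambda>(x, y). x ^ i * y ^ j))"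

text \<open>
  The elements of the space of polynomial functions are \<open>\<mu>\<close>-classes. Throughout, a class is
  handled through its polynomial representatives, and equality of classes is the relation
  \<open>ae_eq \<mu>\<close>. All sets of functions defined below are closed under \<open>ae_eq \<mu>\<close> within the
  polynomial functions, so they are exactly the preimages of the spaces of classes.
\<close>

definition ae_eq :: "'a measure \<Rightarrow> ('a \<Rightarrow> real) \<Rightarrow> ('a \<Rightarrow> real) \<Rightarrow> bool" where
  "ae_eq \<mu> f g \<longleftrightarrow> (AE z in \<mu>. f z = g z)"

definition polys_le :: "nat \<Rightarrow> (real \<times> real \<Rightarrow> real) set" where
  "polys_le n = {f. \<exists>c. f = (\<lambda>(x, y). \<Sum>i\<le>n. \<Sum>j\<le>n - i. c i j * x ^ i * y ^ j)}"

definition polys :: "(real \<times> real \<Rightarrow> real) set" where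
  "polys = (\<Union>n. polys_le n)"

definition F :: "(real \<times> real) measure \<Rightarrow> nat \<Rightarrow> (real \<times> real \<Rightarrow> real) set" where
  "F \<mu> n = {f \<in> polys. \<exists>p \<in> polys_le n. ae_eq \<mu> f p}"

definition inner_L2 :: "'a measure \<Rightarrow> ('a \<Rightarrow> real) \<Rightarrow> ('a \<Rightarrow> real) \<Rightarrow> real" where
  "inner_L2 \<mu> f g = (\<integral>z. f z * g z \<partial>\<mu>)"

text \<open>The index is an integer so that \<open>G \<mu> (-1)\<close> is the zero space.\<close>

definition G :: "(real \<times> real) measure \<Rightarrow> int \<Rightarrow> (real \<times> real \<Rightarrow> real) set" where
  "G \<mu> n =
     (if n < 0 then {f \<in> polys. ae_eq \<mu> f (\<lambda>_. 0)}
      else if n = 0 then F \<mu> 0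
      else {f \<in> F \<mu> (nat n). \<forall>g \<in> F \<mu> (nat n - 1). inner_L2 \<mu> f g = 0})"

type_synonym operator = "(real \<times> real \<Rightarrow> real) \<Rightarrow> (real \<times> real \<Rightarrow> real)"

text \<open>A map on polynomial functions which induces a linear map on the space of classes.\<close>

definition is_operator :: "(real \<times> real) measure \<Rightarrow> operator \<Rightarrow> bool" where
  "is_operator \<mu> A \<longleftrightarrow>
     (\<forall>f \<in> polys. A f \<in> polys) \<and>
     (\<forall>f \<in> polys. \<forall>g \<in> polys. ae_eq \<mu> f g \<longrightarrow> ae_eq \<mu> (A f) (A g)) \<and>
     (\<forall>f \<in> polys. \<forall>g \<in> polys. ae_eq \<mu> (A (\<lambda>z. f z + g z)) (\<lambda>z. A f z + A g z)) \<and>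
     (\<forall>f \<in> polys. \<forall>r. ae_eq \<mu> (A (\<lambda>z. r * f z)) (\<lambda>z. r * A f z))"

definition op_eq :: "(real \<times> real) measure \<Rightarrow> operator \<Rightarrow> operator \<Rightarrow> bool" where
  "op_eq \<mu> A B \<longleftrightarrow> (\<forall>f \<in> polys. ae_eq \<mu> (A f) (B f))"

definition mult_x :: operator where
  "mult_x f = (\<lambda>z. fst z * f z)"

definition mult_y :: operator where
  "mult_y f = (\<lambda>z. snd z * f z)"

text \<open>
  \<open>T = am + a0 + ap\<close>, with annihilation, preservation and creation part. Since the spaces
  \<open>G \<mu> n\<close> are mutually orthogonal and span \<open>polys\<close>, the three parts are determined by \<open>T\<close>
  up to \<open>op_eq \<mu>\<close>.
\<close>

definition quantum_decomposition ::
  "(real \<times> real) measure \<Rightarrow> operator \<Rightarrow> operator \<Rightarrow> operator \<Rightarrow> operator \<Rightarrow> bool" where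
  "quantum_decomposition \<mu> T am a0 ap \<longleftrightarrow>
     is_operator \<mu> am \<and> is_operator \<mu> a0 \<and> is_operator \<mu> ap \<and>
     (\<forall>n::nat. \<forall>f \<in> G \<mu> (int n).
        am f \<in> G \<mu> (int n - 1) \<and> a0 f \<in> G \<mu> (int n) \<and> ap f \<in> G \<mu> (int n + 1)) \<and>
     op_eq \<mu> T (\<lambda>f z. am f z + a0 f z + ap f z)"

definition op_span :: "operator list \<Rightarrow> operator set" where
  "op_span As = {A. \<exists>c::nat \<Rightarrow> real. A = (\<lambda>f z. \<Sum>i<length As. c i * (As ! i) f z)}"

definition commutator :: "operator \<Rightarrow> operator \<Rightarrow> operator" where
  "commutator A B = (\<lambda>f z. A (B f) z - B (A f) z)"

definition meixner_ML_plane :: "(real \<times> real) measure \<Rightarrow> bool" where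
  "meixner_ML_plane \<mu> \<longleftrightarrow>
     prob_space \<mu> \<and> sets \<mu> = sets borel \<and> moments2 \<mu> \<and>
     (\<exists>axm ax0 axp aym ay0 ayp.
        quantum_decomposition \<mu> mult_x axm ax0 axp \<and>
        quantum_decomposition \<mu> mult_y aym ay0 ayp \<and>
        (let L = op_span [axm, ax0, axp, aym, ay0, ayp, \<lambda>f. f]
         in \<forall>A \<in> L. \<forall>B \<in> L. \<exists>C \<in> L. op_eq \<mu> (commutator A B) C))"

definition line :: "real \<Rightarrow> real \<Rightarrow> real \<Rightarrow> (real \<times> real) set" where
  "line a b c = {(x, y). a * x + b * y = c}"

definition supported_by :: "'a measure \<Rightarrow> 'a set \<Rightarrow> bool" where
  "supported_by \<mu> S \<longleftrightarrow> (AE z in \<mu>. z \<in> S)"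


section \<open>Meixner measures of class M_L on the line\<close>

definition msupport :: "'a::topological_space measure \<Rightarrow> 'a set" where
  "msupport M = {x. \<forall>U. open U \<and> x \<in> U \<longrightarrow> emeasure M U \<noteq> 0}"

text \<open>
  \<open>N\<close> is meant to be the number of points of the support of \<open>M\<close>, possibly \<open>\<infinity>\<close>. The monic
  orthogonal polynomials are \<open>f n\<close> for \<open>n \<le> N\<close>; when \<open>N\<close> is finite, \<open>f N\<close> is the monic
  polynomial whose roots are the \<open>N\<close> support points, and the recurrence stops at \<open>n = N - 1\<close>.
  The term with \<open>\<omega> 0\<close> is absent.
\<close>

definition monic_orthogonal_polys :: "real measure \<Rightarrow> enat \<Rightarrow> (nat \<Rightarrow> real poly) \<Rightarrow> bool" where
  "monic_orthogonal_polys M N f \<longleftrightarrow>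
     (\<forall>n. enat n \<le> N \<longrightarrow> degree (f n) = n \<and> lead_coeff (f n) = 1) \<and>
     (\<forall>m n. enat m \<le> N \<and> enat n \<le> N \<and> m \<noteq> n \<longrightarrow> inner_L2 M (poly (f m)) (poly (f n)) = 0)"

definition szego_jacobi :: "real measure \<Rightarrow> enat \<Rightarrow> (nat \<Rightarrow> real) \<Rightarrow> (nat \<Rightarrow> real) \<Rightarrow> bool" where
  "szego_jacobi M N \<alpha> \<omega> \<longleftrightarrow>
     (\<exists>f. monic_orthogonal_polys M N f \<and>
        (\<forall>n. enat n < N \<longrightarrow>
           [:0, 1:] * f n =
             f (Suc n) + smult (\<alpha> n) (f n) + (if n = 0 then 0 else smult (\<omega> n) (f (n - 1)))))"

definition moments1 :: "real measure \<Rightarrow> bool" where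
  "moments1 M \<longleftrightarrow> (\<forall>n. integrable M (\<lambda>x. x ^ n))"

definition meixner_ML_infinite :: "real measure \<Rightarrow> bool" where
  "meixner_ML_infinite M \<longleftrightarrow>
     prob_space M \<and> sets M = sets borel \<and> moments1 M \<and> infinite (msupport M) \<and>
     (\<exists>\<alpha> \<alpha>0 \<beta> t::real. \<beta> \<ge> 0 \<and> t > 0 \<and> (\<alpha> \<noteq> 0 \<or> (\<alpha> = 0 \<and> \<beta> = 0)) \<and>
        szego_jacobi M \<infinity> (\<lambda>n. \<alpha> * real n + \<alpha>0) (\<lambda>n. \<beta> * (real n)\<^sup>2 + (t - \<beta>) * real n))"

definition meixner_ML_finite :: "real measure \<Rightarrow> bool" where
  "meixner_ML_finite M \<longleftrightarrow>
     prob_space M \<and> sets M = sets borel \<and> moments1 M \<and>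
     (\<exists>k\<ge>1. finite (msupport M) \<and> card (msupport M) = k \<and>
        (\<exists>\<alpha> \<alpha>0 \<beta> t::real. \<alpha> \<noteq> 0 \<and> t = - \<beta> * (real k - 1) \<and> (k \<ge> 2 \<longrightarrow> t > 0) \<and>
           szego_jacobi M (enat k) (\<lambda>n. \<alpha> * real n + \<alpha>0)
             (\<lambda>n. \<beta> * (real n)\<^sup>2 + (t - \<beta>) * real n)))"

definition meixner_ML :: "real measure \<Rightarrow> bool" where
  "meixner_ML M \<longleftrightarrow> meixner_ML_infinite M \<or> meixner_ML_finite M"

end

theory Submission
  imports Defs "HOL-Library.Function_Algebras"
begin

text \<open>
  For \<open>u\<close> in the plane let \<open>a\<^sup>-\<^bsub>u\<^esub>, a\<^sup>0\<^bsub>u\<^esub>, a\<^sup>+\<^bsub>u\<^esub>\<close> be the parts of the multiplication by the centred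
  linear form with coefficient vector \<open>u\<close>. Comparing degrees, closure under commutators says that
  \<open>[a\<^sup>-\<^bsub>u\<^esub>, a\<^sup>+\<^bsub>v\<^esub>]\<close> is a scalar plus some \<open>a\<^sup>0\<^bsub>w\<^esub>\<close>, \<open>[a\<^sup>0\<^bsub>u\<^esub>, a\<^sup>+\<^bsub>v\<^esub>]\<close> is some \<open>a\<^sup>+\<^bsub>w\<^esub>\<close> and
  \<open>[a\<^sup>0\<^bsub>u\<^esub>, a\<^sup>0\<^bsub>v\<^esub>]\<close> is some \<open>a\<^sup>0\<^bsub>w\<^esub>\<close>. On the space of polynomials of degree one the operators
  \<open>a\<^sup>0\<^bsub>u\<^esub>\<close> are symmetric matrices given by a symmetric trilinear form, and they commute. Hence
  they have a common orthonormal eigenbasis, in which the trilinear form is diagonal. The Jacobi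
  identity then makes the operators of one basis direction commute with those of the other, so
  the mixed moments of the two coordinates factor, and each coordinate has Szego-Jacobi parameters
  \<open>\<alpha>n\<close> and \<open>\<beta>n\<^sup>2 + (1 - \<beta>)n\<close>. Such parameters bound the \<open>n\<close>-th moment by \<open>K\<^sup>n n!\<close>, which makes
  the laws determinate and turns factorisation of moments into independence.
\<close>

section \<open>Determinacy and independence from moments\<close>

text \<open>The measure may sit on finitely many points or on an algebraic curve, so distinct
  polynomials can agree almost everywhere, and the given operators are linear only up to null sets.
  A linear choice \<open>P\<close> of representatives removes this obstacle, and the algebra then
  takes place in a locale \<open>fock\<close> in which no measure is left. Centring the linear forms
  makes every preservation operator kill the constants, which fixes the scalars in the commutators.
  A coefficient that couples the two directions is only controlled after multiplication by the third
  moment of a direction. That is enough: if this moment is zero, the preservation operator of the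
  direction vanishes altogether. Also \<open>\<beta>\<close> comes out as a multiple of
  \<open>\<alpha>\<close>, which is the restriction on the parameters in the one-dimensional class.
  Mean 0 and variance 1 in the eigenbasis account for \<open>\<alpha>0 = 0\<close> and
  \<open>t = 1\<close>. Finite and infinite support are told apart only at the end: the orthogonal
  polynomials are defined in every degree by their recurrence, and the first one of norm zero counts
  the support points.\<close>

definition factorial_moments :: "'a measure \<Rightarrow> ('a \<Rightarrow> real) \<Rightarrow> real \<Rightarrow> bool" where
  "factorial_moments M X K \<longleftrightarrow> 1 \<le> K \<and>
     (\<forall>n. integrable M (\<lambda>z. X z ^ n) \<and> \<bar>\<integral>z. X z ^ n \<partial>M\<bar> \<le> K ^ n * fact n)"

lemma integrable_abs_power:
  assumes "integrable M (\<lambda>x. f x ^ n :: real)" "f \<in> borel_measurable M"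
  shows "integrable M (\<lambda>x. \<bar>f x\<bar> ^ n)"
  using integrable_abs[OF assms(1)] by (simp add: power_abs)

text \<open>An even moment is already absolute. For odd \<open>m\<close> the inequality
  \<open>0 <= |x|^l * (|x| - 1)^2\<close> with \<open>l = m - 1\<close> bounds \<open>|x|^m\<close>
  by the mean of its two even neighbours; the larger neighbour causes the index
  \<open>Suc m\<close>.\<close>

lemma abs_moment_le:
  fixes M :: "real measure"
  assumes M: "factorial_moments M (\<lambda>x. x) K" and [measurable_cong, simp]: "sets M = sets borel"
  shows "(\<integral>x. \<bar>x\<bar> ^ m \<partial>M) \<le> K ^ Suc m * fact (Suc m)"
proof -
  have K: "1 \<le> K" and int: "\<And>n. integrable M (\<lambda>x. x ^ n)"
    and le: "\<And>n. (\<integral>x. x ^ n \<partial>M) \<le> K ^ n * fact n"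
    using M by (auto simp: factorial_moments_def abs_le_iff)
  have mono: "K ^ n * fact n \<le> K ^ Suc m * fact (Suc m)" if "n \<le> Suc m" for n
    using K that by (intro mult_mono power_increasing fact_mono) auto
  show ?thesis
  proof (cases "even m")
    case True
    then show ?thesis using le[of m] mono[of m] by (simp add: power_even_abs)
  next
    case False
    then obtain l where m: "m = Suc l" and l: "even l" by (cases m) auto
    have "(\<integral>x. \<bar>x\<bar> ^ m \<partial>M) \<le> (\<integral>x. (x ^ l + x ^ Suc (Suc l)) / 2 \<partial>M)"
    proof (rule integral_mono)
      fix x :: real
      have "0 \<le> \<bar>x\<bar> ^ l * (\<bar>x\<bar> - 1)\<^sup>2" by simp
      also have "\<dots> = \<bar>x\<bar> ^ l + \<bar>x\<bar> ^ Suc (Suc l) - 2 * \<bar>x\<bar> ^ m"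
        by (simp add: m power2_eq_square algebra_simps)
      finally show "\<bar>x\<bar> ^ m \<le> (x ^ l + x ^ Suc (Suc l)) / 2"
        using l by (simp add: power_even_abs del: power_Suc)
      show "integrable M (\<lambda>x. (x ^ l + x ^ Suc (Suc l)) / 2)"
        by (intro integrable_divide_zero Bochner_Integration.integrable_add int)
    qed (auto intro: int integrable_abs_power)
    also have "\<dots> = ((\<integral>x. x ^ l \<partial>M) + (\<integral>x. x ^ Suc m \<partial>M)) / 2"
      unfolding m by (subst integral_divide_zero, subst Bochner_Integration.integral_add) (auto intro: int simp del: power_Suc)
    also have "\<dots> \<le> K ^ Suc m * fact (Suc m)"
      using le[of l] le[of "Suc m"] mono[of l] m by (simp del: power_Suc fact_Suc)
    finally show ?thesis .
  qed
qed

text \<open>Up to the factor \<open>\<i> ^ k\<close> this is the \<open>k\<close>-th derivative of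
  the characteristic function at \<open>t\<close>.\<close>

definition char_moment :: "real measure \<Rightarrow> nat \<Rightarrow> real \<Rightarrow> complex" where
  "char_moment M k t = (\<integral>x. complex_of_real (x ^ k) * iexp (t * x) \<partial>M)"

text \<open>Taylor expansion about \<open>t\<close>, integrated term by term. The admissible step
  \<open>h\<close> depends neither on \<open>t\<close> nor on \<open>k\<close>, so the expansion can
  be iterated.\<close>

lemma char_moment_shift:
  fixes M :: "real measure"
  assumes M: "factorial_moments M (\<lambda>x. x) K" and [measurable_cong, simp]: "sets M = sets borel"
    and h: "4 * K * \<bar>h\<bar> \<le> 1"
  shows "(\<lambda>j. (\<i> * h) ^ j / fact j * char_moment M (k + j) t) sums char_moment M k (t + h)"
proof -
  have K: "1 \<le> K" and int: "\<And>n. integrable M (\<lambda>x. x ^ n)"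
    using M by (auto simp: factorial_moments_def)
  define f where "f j x = (\<i> * h) ^ j / fact j * (complex_of_real (x ^ (k + j)) * iexp (t * x))"
    for j and x :: real
  have norm_f: "norm (f j x) = \<bar>h\<bar> ^ j / fact j * \<bar>x\<bar> ^ (k + j)" for j x
    by (simp add: f_def norm_mult norm_divide norm_power power_abs[symmetric] del: of_real_power)
  have int_abs: "integrable M (\<lambda>x. \<bar>x\<bar> ^ n)" for n
    by (intro integrable_abs_power int) simp
  have int_f: "integrable M (f j)" for j
  proof (rule Bochner_Integration.integrable_bound)
    show "integrable M (\<lambda>x. \<bar>h\<bar> ^ j / fact j * \<bar>x\<bar> ^ (k + j))" by (intro integrable_mult_right int_abs)
    show "f j \<in> borel_measurable M" unfolding f_def by measurable
    show "AE x in M. norm (f j x) \<le> norm (\<bar>h\<bar> ^ j / fact j * \<bar>x\<bar> ^ (k + j))"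
      unfolding norm_f by simp
  qed
  have f_sums: "(\<lambda>j. f j x) sums (complex_of_real (x ^ k) * iexp ((t + h) * x))" for x
  proof -
    have 1: "(\<lambda>j. complex_of_real (x ^ k) * iexp (t * x) * ((\<i> * h * x) ^ j /\<^sub>R fact j)) sums
        (complex_of_real (x ^ k) * iexp (t * x) * exp (\<i> * h * x))"
      by (intro sums_mult exp_converges)
    have 2: "complex_of_real (x ^ k) * iexp (t * x) * exp (\<i> * h * x)
        = complex_of_real (x ^ k) * iexp ((t + h) * x)"
      by (simp add: exp_add[symmetric] algebra_simps)
    have 3: "complex_of_real (x ^ k) * iexp (t * x) * ((\<i> * h * x) ^ j /\<^sub>R fact j) = f j x" for j
      by (simp add: f_def power_mult_distrib power_add scaleR_conv_of_real field_simps)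
    show ?thesis using 1 unfolding 2 3 .
  qed
  have summ: "summable (\<lambda>j. \<integral>x. norm (f j x) \<partial>M)"
  proof (rule summable_comparison_test')
    show "summable (\<lambda>j. fact (Suc k) * (2 * K) ^ Suc k * (1/2) ^ j :: real)"
      by (intro summable_mult summable_geometric) simp
    fix j :: nat
    \<comment> \<open>Splitting off \<open>fact j\<close> cancels the denominator of the Taylor
      coefficient, and the binomial coefficient left over costs \<open>2 ^ (k + j + 1)\<close>. The
      terms decay like \<open>(2 * K * |h|) ^ j\<close>, where \<open>4 * K * |h| <= 1\<close> makes
      the ratio at most 1/2.\<close>
    have "fact (k + j + 1) = fact j * fact (k + j + 1 - j) * ((k + j + 1) choose j)"
      by (rule binomial_fact_lemma[symmetric]) simp
    also have "k + j + 1 - j = Suc k" by simp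
    finally have "real (fact (k + j + 1)) = real (fact j * fact (Suc k) * ((k + j + 1) choose j))"
      by (simp only:)
    then have "fact (k + j + 1) = fact j * fact (Suc k) * real ((k + j + 1) choose j)"
      by (simp only: of_nat_mult of_nat_fact)
    also have "\<dots> \<le> fact j * fact (Suc k) * 2 ^ (k + j + 1)"
    proof (rule mult_left_mono)
      show "real ((k + j + 1) choose j) \<le> 2 ^ (k + j + 1)"
        using of_nat_mono[OF binomial_le_pow2[of "k + j + 1" j], where 'a=real] by simp
    qed simp
    finally have fact: "fact (k + j + 1) \<le> (fact j * fact (Suc k) * 2 ^ (k + j + 1) :: real)" .
    have "norm (\<integral>x. norm (f j x) \<partial>M) = \<bar>h\<bar> ^ j / fact j * (\<integral>x. \<bar>x\<bar> ^ (k + j) \<partial>M)"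
      unfolding norm_f by (simp add: abs_mult integral_nonneg_AE)
    also have "\<dots> \<le> \<bar>h\<bar> ^ j / fact j * (K ^ (k + j + 1) * (fact j * fact (Suc k) * 2 ^ (k + j + 1)))"
    proof (rule mult_left_mono)
      have "(\<integral>x. \<bar>x\<bar> ^ (k + j) \<partial>M) \<le> K ^ (k + j + 1) * fact (k + j + 1)"
        using abs_moment_le[OF M, of "k + j"] by simp
      also have "\<dots> \<le> K ^ (k + j + 1) * (fact j * fact (Suc k) * 2 ^ (k + j + 1))"
        using K by (intro mult_left_mono fact) simp
      finally show "(\<integral>x. \<bar>x\<bar> ^ (k + j) \<partial>M) \<le> K ^ (k + j + 1) * (fact j * fact (Suc k) * 2 ^ (k + j + 1))" .
    qed simp
    also have "\<dots> = fact (Suc k) * (2 * K) ^ Suc k * (2 * K * \<bar>h\<bar>) ^ j"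
    proof -
      have "a / fact j * (p * (fact j * q * r)) = q * (r * p) * a" for a p q r :: real
        by simp
      then have "\<bar>h\<bar> ^ j / fact j * (K ^ (k + j + 1) * (fact j * fact (Suc k) * 2 ^ (k + j + 1)))
          = fact (Suc k) * (2 ^ (k + j + 1) * K ^ (k + j + 1)) * \<bar>h\<bar> ^ j" by blast
      moreover have "2 ^ (k + j + 1) * K ^ (k + j + 1) = (2 * K) ^ Suc k * (2 * K) ^ j"
        unfolding power_mult_distrib[symmetric] power_add[symmetric] by (simp add: add.commute)
      ultimately show ?thesis
        unfolding power_mult_distrib[of "2 * K" "\<bar>h\<bar>"] by (simp only: mult.assoc)
    qed
    also have "\<dots> \<le> fact (Suc k) * (2 * K) ^ Suc k * (1/2) ^ j"
      using h K by (intro mult_left_mono power_mono) auto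
    finally show "norm (\<integral>x. norm (f j x) \<partial>M) \<le> fact (Suc k) * (2 * K) ^ Suc k * (1/2) ^ j" .
  qed
  have ae: "AE x in M. summable (\<lambda>j. norm (f j x))"
  proof (rule AE_I2)
    fix x
    have 1: "(\<lambda>j. \<bar>x\<bar> ^ k * ((\<bar>h\<bar> * \<bar>x\<bar>) ^ j /\<^sub>R fact j)) sums (\<bar>x\<bar> ^ k * exp (\<bar>h\<bar> * \<bar>x\<bar>))"
      by (intro sums_mult exp_converges)
    have 2: "\<bar>x\<bar> ^ k * ((\<bar>h\<bar> * \<bar>x\<bar>) ^ j /\<^sub>R fact j) = norm (f j x)" for j
      by (simp only: norm_f power_add power_mult_distrib real_scaleR_def divide_inverse mult_ac)
    show "summable (\<lambda>j. norm (f j x))" using sums_summable[OF 1] unfolding 2 .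
  qed
  have "(\<lambda>j. integral\<^sup>L M (f j)) sums (\<integral>x. (\<Sum>j. f j x) \<partial>M)"
    by (rule sums_integral[OF int_f ae summ])
  moreover have "(\<Sum>j. f j x) = complex_of_real (x ^ k) * iexp ((t + h) * x)" for x
    using f_sums[of x] by (simp add: sums_iff)
  moreover have "integral\<^sup>L M (f j) = (\<i> * h) ^ j / fact j * char_moment M (k + j) t" for j
    unfolding f_def char_moment_def by (rule integral_mult_right_zero)
  ultimately show ?thesis by (simp add: char_moment_def)
qed

text \<open>All derivatives of the two characteristic functions agree at 0. Equal steps of length at
  most \<open>1 / (4 * K)\<close> carry the agreement of all derivatives along the line, so every
  \<open>t\<close> is reached. The growth bound passes from \<open>M\<close> to \<open>N\<close>
  with the moments.\<close>

lemma moment_determinacy: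
  assumes M: "real_distribution M" "factorial_moments M (\<lambda>x. x) K"
    and N: "real_distribution N" "\<And>n. integrable N (\<lambda>x. x ^ n)"
    and eq: "\<And>n. (\<integral>x. x ^ n \<partial>M) = (\<integral>x. x ^ n \<partial>N)"
  shows "M = N"
proof (rule Levy_uniqueness)
  have N': "factorial_moments N (\<lambda>x. x) K" using M(2) N(2) eq by (simp add: factorial_moments_def)
  have K: "1 \<le> K" using M(2) by (simp add: factorial_moments_def)
  have sets: "sets M = sets borel" "sets N = sets borel"
    using M(1) N(1) by (simp_all add: real_distribution.events_eq_borel)
  show "char M = char N"
  proof
    fix t :: real
    obtain m :: nat where m: "4 * K * \<bar>t\<bar> < m" "m > 0"
      using reals_Archimedean2[of "max 1 (4 * K * \<bar>t\<bar>)"] by auto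
    define h where "h = t / m"
    have h: "4 * K * \<bar>h\<bar> \<le> 1" using m by (simp add: h_def field_simps)
    have "\<forall>k. char_moment M k (real i * h) = char_moment N k (real i * h)" for i
    proof (induction i)
      case 0
      then show ?case
        using eq by (simp add: char_moment_def del: of_real_power)
    next
      case (Suc i)
      have "char_moment M k (real i * h + h) = char_moment N k (real i * h + h)" for k
        using char_moment_shift[OF M(2) sets(1) h, of k "real i * h"]
          char_moment_shift[OF N' sets(2) h, of k "real i * h"] Suc
        by (simp add: sums_unique2)
      then show ?case by (simp add: algebra_simps)
    qed
    from this[of m] have "char_moment M 0 t = char_moment N 0 t"
      using m by (simp add: h_def)
    then show "char M t = char N t" by (simp add: char_moment_def char_def)
  qed
qed (use assms in auto)

text \<open>The law of \<open>Y\<close> under the measure reweighted by \<open>Z\<close> has the same moments as \<open>Y\<close>.\<close>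

lemma (in prob_space) weight_independent:
  fixes Y Z :: "'a \<Rightarrow> real"
  assumes Y: "factorial_moments M Y K" and [measurable]: "Y \<in> borel_measurable M" "B \<in> sets borel"
    and Z: "integrable M Z" "\<And>z. 0 \<le> Z z"
    and ZY: "\<And>n. integrable M (\<lambda>z. Z z * Y z ^ n)"
      "\<And>n. expectation (\<lambda>z. Z z * Y z ^ n) = expectation Z * expectation (\<lambda>z. Y z ^ n)"
  shows "expectation (\<lambda>z. Z z * indicator B (Y z)) = expectation Z * prob {z \<in> space M. Y z \<in> B}"
proof -
  have [measurable]: "Z \<in> borel_measurable M" using Z(1) by auto
  define e where "e = expectation Z"
  have "0 \<le> e" using Z by (simp add: e_def)
  show ?thesis
  proof (cases "e = 0")
    case True
    then have "AE z in M. Z z = 0"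
      using Z integral_nonneg_eq_0_iff_AE[OF Z(1)] by (simp add: e_def)
    then have "expectation (\<lambda>z. Z z * indicator B (Y z)) = expectation (\<lambda>z. 0)"
      by (intro integral_cong_AE) auto
    then show ?thesis using True by (simp add: e_def)
  next
    case False
    then have e: "e > 0" using \<open>0 \<le> e\<close> by simp
    define D where "D = density M (\<lambda>z. ennreal (Z z / e))"
    have intD: "integral\<^sup>L D f = expectation (\<lambda>z. Z z * f z) / e" if "f \<in> borel_measurable M" for f :: "'a \<Rightarrow> real"
      unfolding D_def using Z e that by (subst integral_density) auto
    have integrableD: "integrable D f" if "integrable M (\<lambda>z. Z z * f z)" "f \<in> borel_measurable M" for f :: "'a \<Rightarrow> real"
      unfolding D_def using Z e that by (subst integrable_density) auto
    interpret D: prob_space D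
    proof
      have "emeasure D (space D) = (\<integral>\<^sup>+z. ennreal (Z z / e) \<partial>M)"
        unfolding D_def by (subst emeasure_density) (auto intro!: nn_integral_cong)
      also have "\<dots> = ennreal (expectation (\<lambda>z. Z z / e))"
        using Z e by (intro nn_integral_eq_integral) auto
      also have "expectation (\<lambda>z. Z z / e) = 1" using e by (simp add: e_def)
      finally show "emeasure D (space D) = 1" by simp
    qed
    have [measurable_cong]: "sets D = sets M" by (simp add: D_def)
    have "distr M borel Y = distr D borel Y"
    proof (rule moment_determinacy)
      show "real_distribution (distr M borel Y)" "real_distribution (distr D borel Y)"
        by (auto simp: real_distribution_def real_distribution_axioms_def
            intro!: prob_space_distr D.prob_space_distr)
      show "factorial_moments (distr M borel Y) (\<lambda>x. x) K"
        using Y by (auto simp: factorial_moments_def integrable_distr_eq integral_distr)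
      show "integrable (distr D borel Y) (\<lambda>x. x ^ n)" for n
        using integrableD[OF ZY(1)] by (auto simp: integrable_distr_eq)
      show "(\<integral>x. x ^ n \<partial>distr M borel Y) = (\<integral>x. x ^ n \<partial>distr D borel Y)" for n
        using e by (simp add: integral_distr intD ZY(2) e_def)
    qed
    then have "measure (distr M borel Y) B = measure (distr D borel Y) B" by simp
    then have "prob {z \<in> space M. Y z \<in> B} = measure D {z \<in> space D. Y z \<in> B}"
      by (simp add: measure_distr vimage_def Int_def conj_commute)
    also have "\<dots> = (\<integral>z. indicator {z \<in> space D. Y z \<in> B} z \<partial>D)"
      by simp
    also have "\<dots> = (\<integral>z. indicator B (Y z) \<partial>D)"
      by (intro Bochner_Integration.integral_cong) (auto simp: indicator_def)
    also have "\<dots> = expectation (\<lambda>z. Z z * indicator B (Y z)) / e"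
      by (rule intD) simp
    finally show ?thesis using e by (simp add: e_def field_simps)
  qed
qed

text \<open>One variable is replaced at a time. Weights built from powers of \<open>X\<close> leave
  the law of \<open>Y\<close> unchanged, so \<open>Y ^ n\<close> gives way to the indicator of
  \<open>Y \<in> B\<close>; that indicator then serves as the weight for \<open>X\<close>. This
  yields the product formula on rectangles, which determine the measure.\<close>

lemma (in prob_space) product_of_moments:
  fixes X Y :: "'a \<Rightarrow> real"
  assumes X: "factorial_moments M X K" and Y: "factorial_moments M Y K'"
    and [measurable]: "X \<in> borel_measurable M" "Y \<in> borel_measurable M"
    and XY: "\<And>m n. integrable M (\<lambda>z. X z ^ m * Y z ^ n)"
      "\<And>m n. expectation (\<lambda>z. X z ^ m * Y z ^ n) = expectation (\<lambda>z. X z ^ m) * expectation (\<lambda>z. Y z ^ n)"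
  shows "distr M borel (\<lambda>z. (X z, Y z)) = distr M borel X \<Otimes>\<^sub>M distr M borel Y"
proof -
  have intX: "integrable M (\<lambda>z. X z ^ n)" for n using X by (simp add: factorial_moments_def)
  have intY: "integrable M (\<lambda>z. Y z ^ n)" for n using Y by (simp add: factorial_moments_def)
  have weighted_power: "integrable M (\<lambda>z. X z ^ n * indicator B (Y z))"
    "expectation (\<lambda>z. X z ^ n * indicator B (Y z)) = expectation (\<lambda>z. X z ^ n) * prob {z \<in> space M. Y z \<in> B}"
    if [measurable]: "B \<in> sets borel" for n B
  proof -
    let ?b = "\<lambda>z. indicator B (Y z) :: real"
    have b: "expectation ?b = prob {z \<in> space M. Y z \<in> B}"
    proof -
      have "expectation ?b = expectation (indicator {z \<in> space M. Y z \<in> B})"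
        by (intro Bochner_Integration.integral_cong) (auto simp: indicator_def)
      then show ?thesis by simp
    qed
    have int_b: "integrable M (\<lambda>z. X z ^ k * ?b z)" for k
      by (rule Bochner_Integration.integrable_bound[OF intX[of k]]) (auto simp: indicator_def)
    have int_b': "integrable M ?b" using int_b[of 0] by simp
    \<comment> \<open>Weights must be nonnegative, so \<open>X ^ n\<close> is recovered from \<open>(1 + X ^ n)\<^sup>2\<close> and \<open>X ^ (2 * n)\<close>.\<close>
    have even: "expectation (\<lambda>z. X z ^ (2 * n) * ?b z) = expectation (\<lambda>z. X z ^ (2 * n)) * prob {z \<in> space M. Y z \<in> B}"
      by (rule weight_independent[OF Y]) (auto intro: intX XY(1) simp: XY(2))
    define S where "S z = (1 + X z ^ n) * (1 + X z ^ n)" for z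
    have S: "S z * r = r + 2 * (X z ^ n * r) + X z ^ (2 * n) * r" for z r
      unfolding S_def mult_2[of n] power_add by algebra
    have S1: "S z = 1 + 2 * X z ^ n + X z ^ (2 * n)" for z
      using S[of z 1] by simp
    have ES: "expectation S = 1 + 2 * expectation (\<lambda>z. X z ^ n) + expectation (\<lambda>z. X z ^ (2 * n))"
      unfolding S1 by (simp add: intX prob_space)
    have "expectation (\<lambda>z. S z * ?b z) = expectation S * prob {z \<in> space M. Y z \<in> B}"
    proof (rule weight_independent[OF Y])
      show "integrable M S" unfolding S1 by (simp add: intX)
      show "integrable M (\<lambda>z. S z * Y z ^ k)" for k
        unfolding S by (simp add: intY XY(1))
      show "expectation (\<lambda>z. S z * Y z ^ k) = expectation S * expectation (\<lambda>z. Y z ^ k)" for k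
        unfolding S ES by (simp add: intY XY) (simp add: algebra_simps)
    qed (auto simp: S_def)
    then have "prob {z \<in> space M. Y z \<in> B} + 2 * expectation (\<lambda>z. X z ^ n * ?b z)
        + expectation (\<lambda>z. X z ^ (2 * n) * ?b z)
        = (1 + 2 * expectation (\<lambda>z. X z ^ n) + expectation (\<lambda>z. X z ^ (2 * n))) * prob {z \<in> space M. Y z \<in> B}"
      unfolding S ES by (simp add: int_b int_b' b)
    then show "expectation (\<lambda>z. X z ^ n * ?b z) = expectation (\<lambda>z. X z ^ n) * prob {z \<in> space M. Y z \<in> B}"
      unfolding even by (simp add: algebra_simps)
    show "integrable M (\<lambda>z. X z ^ n * ?b z)" by (rule int_b)
  qed
  have rect: "prob {z \<in> space M. X z \<in> A \<and> Y z \<in> B} = prob {z \<in> space M. X z \<in> A} * prob {z \<in> space M. Y z \<in> B}"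
    if [measurable]: "A \<in> sets borel" "B \<in> sets borel" for A B
  proof -
    have b: "expectation (\<lambda>z. indicator B (Y z)) = prob {z \<in> space M. Y z \<in> B}"
      using weighted_power(2)[of B 0] by (simp add: prob_space)
    have "expectation (\<lambda>z. indicator B (Y z) * indicator A (X z) :: real)
        = expectation (\<lambda>z. indicator B (Y z)) * prob {z \<in> space M. X z \<in> A}"
    proof (rule weight_independent[OF X])
      show "integrable M (\<lambda>z. indicator B (Y z) :: real)" using weighted_power(1)[of B 0] by simp
      show "integrable M (\<lambda>z. indicator B (Y z) * X z ^ n)" for n
        using weighted_power(1)[of B n] by (simp add: mult.commute)
      show "expectation (\<lambda>z. indicator B (Y z) * X z ^ n)
          = expectation (\<lambda>z. indicator B (Y z)) * expectation (\<lambda>z. X z ^ n)" for n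
        using weighted_power(2)[of B n] b by (simp add: mult.commute)
    qed auto
    moreover have "expectation (\<lambda>z. indicator B (Y z) * indicator A (X z) :: real)
        = expectation (indicator {z \<in> space M. X z \<in> A \<and> Y z \<in> B})"
      by (intro Bochner_Integration.integral_cong) (simp_all split: split_indicator)
    ultimately show ?thesis using b by (simp add: mult.commute)
  qed
  show ?thesis
  proof (rule pair_measure_eqI[symmetric])
    show "sigma_finite_measure (distr M borel X)" "sigma_finite_measure (distr M borel Y)"
      by (intro prob_space_imp_sigma_finite prob_space_distr; simp)+
    show "sets (distr M borel X \<Otimes>\<^sub>M distr M borel Y) = sets (distr M borel (\<lambda>z. (X z, Y z)))"
    proof -
      have "sets (distr M borel X \<Otimes>\<^sub>M distr M borel Y) = sets (borel \<Otimes>\<^sub>M borel)"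
        by (rule sets_pair_measure_cong) simp_all
      also have "\<dots> = sets borel" by (simp only: borel_prod)
      finally show ?thesis by simp
    qed
    fix A B assume "A \<in> sets (distr M borel X)" "B \<in> sets (distr M borel Y)"
    then have [measurable]: "A \<in> sets borel" "B \<in> sets borel" by simp_all
    have "A \<times> B \<in> sets borel" unfolding borel_prod[symmetric] by simp
    then have "emeasure (distr M borel (\<lambda>z. (X z, Y z))) (A \<times> B)
        = prob {z \<in> space M. X z \<in> A \<and> Y z \<in> B}"
      by (simp add: emeasure_distr vimage_def Int_def conj_commute emeasure_eq_measure)
    moreover have "emeasure (distr M borel X) A = prob {z \<in> space M. X z \<in> A}"
      "emeasure (distr M borel Y) B = prob {z \<in> space M. Y z \<in> B}"
      by (simp_all add: emeasure_distr vimage_def Int_def conj_commute emeasure_eq_measure)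
    ultimately show "emeasure (distr M borel X) A * emeasure (distr M borel Y) B
        = emeasure (distr M borel (\<lambda>z. (X z, Y z))) (A \<times> B)"
      by (simp add: rect ennreal_mult'')
  qed
qed

section \<open>One-dimensional laws\<close>

text \<open>The complement of the support is the union of all open null sets; by the Lindelof
  property countably many of them cover it.\<close>

lemma AE_msupport:
  fixes M :: "'a::second_countable_topology measure"
  assumes "sets M = sets borel"
  shows "AE x in M. x \<in> msupport M"
proof -
  define N where "N = {U. open U \<and> emeasure M U = 0}"
  obtain N' where N': "N' \<subseteq> N" "countable N'" "\<Union>N' = \<Union>N"
    using Lindelof[of N] by (auto simp: N_def)
  have "(\<Union>U\<in>N'. U) \<in> null_sets M"
    using N'(1,2) assms by (intro null_sets_UN') (auto simp: N_def null_sets_def)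
  moreover have "x \<in> (\<Union>U\<in>N'. U)" if "x \<notin> msupport M" for x
    using that N'(3) by (auto simp: msupport_def N_def)
  ultimately show ?thesis
    by (intro AE_I'[of "\<Union>U\<in>N'. U"]) auto
qed

text \<open>With the recurrence as definition the polynomials exist in every degree, however few
  points a measure charges. The value \<open>w 0\<close> never enters.\<close>

fun jacobi_poly :: "(nat \<Rightarrow> real) \<Rightarrow> (nat \<Rightarrow> real) \<Rightarrow> nat \<Rightarrow> real poly" where
  "jacobi_poly a w 0 = 1"
| "jacobi_poly a w (Suc 0) = [:- a 0, 1:]"
| "jacobi_poly a w (Suc (Suc n)) =
     [:- a (Suc n), 1:] * jacobi_poly a w (Suc n) - smult (w (Suc n)) (jacobi_poly a w n)"

lemma jacobi_poly_recurrence: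
  "[:0, 1:] * jacobi_poly a w n = jacobi_poly a w (Suc n) + smult (a n) (jacobi_poly a w n)
     + (if n = 0 then 0 else smult (w n) (jacobi_poly a w (n - 1)))"
  by (cases n) (simp_all add: smult_add_right[symmetric] one_pCons)

lemma jacobi_poly_monic: "degree (jacobi_poly a w n) = n \<and> lead_coeff (jacobi_poly a w n) = 1"
proof (induction a w n rule: jacobi_poly.induct)
  case (3 a w n)
  let ?p = "[:- a (Suc n), 1:] * jacobi_poly a w (Suc n)"
  have "jacobi_poly a w (Suc n) \<noteq> 0" using 3(1) by (metis coeff_0 zero_neq_one)
  then have p: "degree ?p = Suc (Suc n)" "lead_coeff ?p = 1"
    using 3(1) by (simp add: degree_mult_eq del: mult_pCons_left, simp only: lead_coeff_mult, simp)
  have q: "degree (smult (w (Suc n)) (jacobi_poly a w n)) < Suc (Suc n)"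
    using 3 degree_smult_le[of "w (Suc n)" "jacobi_poly a w n"] by simp
  have "degree (jacobi_poly a w (Suc (Suc n))) = Suc (Suc n)"
    unfolding jacobi_poly.simps diff_conv_add_uminus using p q
    by (subst degree_add_eq_left) (auto simp del: mult_pCons_left)
  moreover have "coeff (jacobi_poly a w (Suc (Suc n))) (Suc (Suc n)) = 1"
    unfolding jacobi_poly.simps coeff_diff using p coeff_eq_0[OF q] by simp
  ultimately show ?case by simp
qed simp_all

lemmas degree_jacobi_poly [simp] = jacobi_poly_monic[THEN conjunct1]

lemma integrable_poly:
  fixes X :: "'a \<Rightarrow> real"
  assumes "\<And>n. integrable M (\<lambda>z. X z ^ n)"
  shows "integrable M (\<lambda>z. poly p (X z))"
  unfolding poly_altdef by (intro Bochner_Integration.integrable_sum integrable_mult_right assms)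

text \<open>The expectations \<open>d n k\<close> of \<open>X ^ n\<close> times the
  \<open>k\<close>-th polynomial inherit the three-term recurrence, which lowers \<open>n\<close> at
  the price of moving \<open>k\<close> by at most one; at \<open>n = 0\<close> they are known.
  Induction on \<open>n\<close> bounds them all, and \<open>k = 0\<close> gives the moments.\<close>

lemma factorial_moments_of_jacobi:
  fixes X :: "'a \<Rightarrow> real"
  assumes M: "prob_space M" and int: "\<And>n. integrable M (\<lambda>z. X z ^ n)"
    and mean: "\<And>k. k > 0 \<Longrightarrow> (\<integral>z. poly (jacobi_poly a w k) (X z) \<partial>M) = 0"
    and A: "0 \<le> A" "\<And>n. \<bar>a n\<bar> \<le> A * (real n + 1)" "\<And>n. \<bar>w n\<bar> \<le> A * (real n)\<^sup>2"
  shows "factorial_moments M X (2 * (1 + 2 * A))"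
proof -
  interpret prob_space M by fact
  define K where "K = 2 * (1 + 2 * A)"
  define d where "d n k = expectation (\<lambda>z. X z ^ n * poly (jacobi_poly a w k) (X z))" for n k
  have int_d: "integrable M (\<lambda>z. X z ^ n * poly p (X z))" for n p
    using integrable_poly[OF int, of "monom 1 n * p"] by (simp add: poly_monom)
  have d_0: "d 0 k = (if k = 0 then 1 else 0)" for k
    using mean[of k] by (auto simp: d_def prob_space)
  have d_Suc: "d (Suc n) k = d n (Suc k) + a k * d n k + (if k = 0 then 0 else w k * d n (k - 1))" for n k
  proof -
    have "X z ^ Suc n * poly (jacobi_poly a w k) (X z) = X z ^ n * poly ([:0, 1:] * jacobi_poly a w k) (X z)" for z
      by (simp add: algebra_simps)
    also have "\<dots> z = X z ^ n * poly (jacobi_poly a w (Suc k)) (X z)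
        + a k * (X z ^ n * poly (jacobi_poly a w k) (X z))
        + (if k = 0 then 0 else w k) * (X z ^ n * poly (jacobi_poly a w (k - 1)) (X z))" for z
      unfolding jacobi_poly_recurrence by (simp add: algebra_simps)
    finally show ?thesis unfolding d_def by (simp add: int_d del: power_Suc)
  qed
  have bound: "\<bar>d n k\<bar> \<le> K ^ n * fact n * fact k \<and> (n < k \<longrightarrow> d n k = 0)" for n k
  proof (induction n arbitrary: k)
    case 0
    then show ?case by (simp add: d_0)
  next
    case (Suc n)
    show ?case
    proof (cases "Suc n < k")
      case True
      then have "n < Suc k" "n < k" "n < k - 1" by auto
      then have "d (Suc n) k = 0" unfolding d_Suc using Suc by simp
      then show ?thesis using A by (simp add: K_def)
    next
      case False
      define B where "B = K ^ n * fact n * fact k"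
      have B: "0 \<le> B" using A by (simp add: B_def K_def)
      have 1: "\<bar>d n (Suc k)\<bar> \<le> B * (real k + 1)"
        using Suc[of "Suc k"] by (simp add: B_def algebra_simps)
      have "\<bar>a k\<bar> * \<bar>d n k\<bar> \<le> (A * (real k + 1)) * B"
        using Suc[of k] A by (intro mult_mono) (auto simp: B_def)
      then have 2: "\<bar>a k * d n k\<bar> \<le> B * (A * (real k + 1))"
        by (simp add: abs_mult mult.commute)
      have 3: "\<bar>if k = 0 then 0 else w k * d n (k - 1)\<bar> \<le> B * (A * (real k + 1))"
      proof (cases k)
        case (Suc l)
        have "\<bar>w k\<bar> * \<bar>d n l\<bar> \<le> (A * (real k)\<^sup>2) * (K ^ n * fact n * fact l)"
          using Suc.IH[of l] A by (intro mult_mono) auto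
        also have "\<dots> = B * (A * real k)"
          by (simp add: B_def Suc power2_eq_square)
        also have "\<dots> \<le> B * (A * (real k + 1))"
          using A B by (intro mult_left_mono) auto
        finally show ?thesis using Suc by (simp add: abs_mult)
      qed (use A B in auto)
      have "\<bar>d (Suc n) k\<bar> \<le> B * (real k + 1) + B * (A * (real k + 1)) + B * (A * (real k + 1))"
        unfolding d_Suc using 1 2 3 by linarith
      also have "\<dots> = B * ((1 + 2 * A) * (real k + 1))"
        by (simp add: algebra_simps)
      also have "\<dots> \<le> B * ((1 + 2 * A) * (2 * real (Suc n)))"
        using False A B by (intro mult_left_mono) auto
      also have "\<dots> = K ^ Suc n * fact (Suc n) * fact k"
        by (simp add: B_def K_def algebra_simps)
      finally show ?thesis using False by simp
    qed
  qed
  show ?thesis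
    unfolding factorial_moments_def using A int bound[of _ 0]
    by (auto simp: d_def K_def)
qed

text \<open>Normalised to \<open>\<alpha>0 = 0\<close> and \<open>t = 1\<close>. Orthogonality in
  all degrees is compatible with finite support, since from some degree on the polynomials then
  vanish almost everywhere.\<close>

locale jacobi_measure = prob_space M for M :: "real measure" +
  fixes \<alpha> \<beta> :: real and p :: "nat \<Rightarrow> real poly"
  defines "p \<equiv> jacobi_poly (\<lambda>n. \<alpha> * real n) (\<lambda>n. \<beta> * (real n)\<^sup>2 + (1 - \<beta>) * real n)"
  assumes borel: "sets M = sets borel" and moments: "integrable M (\<lambda>x. x ^ n)"
    and orthogonal: "m \<noteq> n \<Longrightarrow> (\<integral>x. poly (p m) x * poly (p n) x \<partial>M) = 0"
    and degenerate: "\<alpha> = 0 \<Longrightarrow> \<beta> = 0"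
begin

lemma integrable_polys: "integrable M (poly q)" "integrable M (\<lambda>x. poly q x * poly r x)"
  using integrable_poly[of M "\<lambda>x. x" q] integrable_poly[of M "\<lambda>x. x" "q * r"] moments by simp_all

lemma monic: "degree (p n) = n" "lead_coeff (p n) = 1" "p n \<noteq> 0"
  unfolding p_def using jacobi_poly_monic by (force, force, metis coeff_0 zero_neq_one)

lemma orthogonal_lower: "q = 0 \<or> degree q < n \<Longrightarrow> (\<integral>x. poly (p n) x * poly q x \<partial>M) = 0"
proof (induction "degree q" arbitrary: q rule: less_induct)
  case less
  show ?case
  proof (cases "q = 0")
    case False
    define d where "d = degree q"
    define r where "r = q - smult (lead_coeff q) (p d)"
    have d: "d < n" using less False by (simp add: d_def)
    have c: "coeff r d = 0" "degree r \<le> d"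
      using monic[of d] unfolding r_def
      by (auto simp: d_def intro!: degree_diff_le order_trans[OF degree_smult_le])
    have "(\<integral>x. poly (p n) x * poly r x \<partial>M) = 0"
    proof (cases "degree r < d")
      case True
      then show ?thesis using less(1)[of r] d by (simp add: d_def)
    next
      case False
      then have "r = 0" using c by (metis le_neq_implies_less leading_coeff_0_iff)
      then show ?thesis by simp
    qed
    moreover have "poly (p n) x * poly q x
        = poly (p n) x * poly r x + lead_coeff q * (poly (p n) x * poly (p d) x)" for x
      by (simp add: r_def algebra_simps)
    ultimately show ?thesis
      using orthogonal[of n d] d by (simp add: integrable_polys)
  qed simp
qed

definition norm2 :: "nat \<Rightarrow> real" where
  "norm2 n = (\<integral>x. poly (p n) x * poly (p n) x \<partial>M)"

lemma norm2_nonneg: "0 \<le> norm2 n"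
  unfolding norm2_def by (intro integral_nonneg_AE) simp

lemma norm2_0: "norm2 0 = 1"
  by (simp add: norm2_def p_def prob_space)

lemma recurrence:
  "[:0, 1:] * p n = p (Suc n) + smult (\<alpha> * real n) (p n)
     + (if n = 0 then 0 else smult (\<beta> * (real n)\<^sup>2 + (1 - \<beta>) * real n) (p (n - 1)))"
  unfolding p_def by (rule jacobi_poly_recurrence)

text \<open>Since \<open>p (Suc n)\<close> and \<open>x * p n\<close> are both monic, the square
  norm of the former is their inner product. Moving the factor \<open>x\<close> to the other side
  leaves only the lowest term of the recurrence for \<open>p (Suc n)\<close>.\<close>

lemma norm2_Suc: "norm2 (Suc n) = real (Suc n) * (1 + \<beta> * real n) * norm2 n"
proof -
  define w where "w = \<beta> * (real (Suc n))\<^sup>2 + (1 - \<beta>) * real (Suc n)"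
  have "norm2 (Suc n) = (\<integral>x. poly (p (Suc n)) x * poly ([:0, 1:] * p n) x \<partial>M)"
  proof -
    have "(\<integral>x. poly (p (Suc n)) x * poly ([:0, 1:] * p n - p (Suc n)) x \<partial>M) = 0"
    proof (rule orthogonal_lower)
      have "degree ([:0, 1:] * p n - p (Suc n)) \<le> n"
        unfolding recurrence using monic
        by (auto intro!: degree_add_le order_trans[OF degree_smult_le])
      then show "[:0, 1:] * p n - p (Suc n) = 0 \<or> degree ([:0, 1:] * p n - p (Suc n)) < Suc n"
        by simp
    qed
    then have "(\<integral>x. poly (p (Suc n)) x * poly ([:0, 1:] * p n) x
        - poly (p (Suc n)) x * poly (p (Suc n)) x \<partial>M) = 0"
      by (simp only: poly_diff right_diff_distrib)
    then show ?thesis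
      unfolding Bochner_Integration.integral_diff[OF integrable_polys(2) integrable_polys(2)]
        norm2_def by linarith
  qed
  also have "\<dots> = (\<integral>x. poly (p n) x * poly ([:0, 1:] * p (Suc n)) x \<partial>M)"
    by (intro Bochner_Integration.integral_cong) (simp_all add: mult_ac)
  also have "\<dots> = (\<integral>x. poly (p n) x * poly (p (Suc (Suc n))) x
      + \<alpha> * real (Suc n) * (poly (p n) x * poly (p (Suc n)) x)
      + w * (poly (p n) x * poly (p n) x) \<partial>M)"
    unfolding recurrence by (intro Bochner_Integration.integral_cong) (simp_all add: w_def algebra_simps)
  also have "\<dots> = w * norm2 n"
    using orthogonal[of n "Suc (Suc n)"] orthogonal[of n "Suc n"]
    by (simp add: integrable_polys norm2_def)
  also have "w = real (Suc n) * (1 + \<beta> * real n)"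
    by (simp add: w_def power2_eq_square algebra_simps)
  finally show ?thesis .
qed

lemma norm2_eq_0_iff: "norm2 n = 0 \<longleftrightarrow> (AE x in M. poly (p n) x = 0)"
  unfolding norm2_def by (subst integral_nonneg_eq_0_iff_AE) (auto simp: integrable_polys)

text \<open>The difference of \<open>p n\<close> and a monic polynomial of degree \<open>n\<close>
  has lower degree and is orthogonal to \<open>p n\<close>; if that polynomial vanishes almost
  everywhere, the inner product is also the square norm of \<open>p n\<close>.\<close>

lemma norm2_eq_0_of_annihilator:
  assumes "lead_coeff q = 1" "AE x in M. poly q x = 0"
  shows "norm2 (degree q) = 0"
proof (cases "degree q = 0")
  case True
  then have "q = 1" using assms(1) by (metis degree_0_id of_nat_1 one_pCons lead_coeff_1 degree_eq_zeroE pCons_0_0 coeff_pCons_0)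
  then show ?thesis using assms(2) by simp
next
  case False
  let ?n = "degree q"
  have "coeff (p ?n - q) ?n = 0" "degree (p ?n - q) \<le> ?n"
    using monic[of ?n] assms(1) by (auto intro!: degree_diff_le)
  then have "degree (p ?n - q) < ?n"
    using False by (metis degree_0 le_neq_implies_less leading_coeff_0_iff neq0_conv)
  then have "(\<integral>x. poly (p ?n) x * poly (p ?n - q) x \<partial>M) = 0" by (intro orthogonal_lower) simp
  moreover have "(\<integral>x. poly (p ?n) x * poly (p ?n - q) x \<partial>M) = norm2 ?n"
    unfolding norm2_def using assms(2) integrable_polys
    by (intro integral_cong_AE) (auto intro: borel_measurable_integrable)
  ultimately show ?thesis by simp
qed

lemma norm2_card_msupport:
  assumes "finite (msupport M)"
  shows "norm2 (card (msupport M)) = 0"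
proof -
  define q where "q = (\<Prod>s\<in>msupport M. [:- s, 1:])"
  have "lead_coeff q = 1" unfolding q_def lead_coeff_prod by simp
  moreover have "degree q = card (msupport M)"
    unfolding q_def by (simp add: degree_prod_eq_sum_degree)
  moreover have "AE x in M. poly q x = 0"
    using AE_msupport[OF borel]
    by eventually_elim (use assms in \<open>auto simp: q_def poly_prod\<close>)
  ultimately show ?thesis using norm2_eq_0_of_annihilator by metis
qed

lemma monic_orthogonal: "monic_orthogonal_polys M N p"
  using monic orthogonal by (auto simp: monic_orthogonal_polys_def inner_L2_def)

lemma szego_jacobi: "szego_jacobi M N (\<lambda>n. \<alpha> * real n + 0)
    (\<lambda>n. \<beta> * (real n)\<^sup>2 + (1 - \<beta>) * real n)"
  unfolding szego_jacobi_def using monic_orthogonal recurrence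
  by (intro exI[of _ p]) (auto simp del: mult_pCons_left)

lemma meixner_infinite:
  assumes "\<And>n. norm2 n \<noteq> 0"
  shows "meixner_ML_infinite M"
proof -
  have "infinite (msupport M)" using norm2_card_msupport assms by blast
  \<comment> \<open>A negative \<open>\<beta>\<close> would make \<open>1 + \<beta> * n\<close>
    negative for large \<open>n\<close>, and with it a square norm.\<close>
  moreover have "0 \<le> \<beta>"
  proof (rule ccontr)
    assume "\<not> 0 \<le> \<beta>"
    then obtain n :: nat where n: "1 / - \<beta> < n" using reals_Archimedean2 by blast
    then have "1 + \<beta> * real n < 0" using \<open>\<not> 0 \<le> \<beta>\<close> by (simp add: field_simps)
    then have "real (Suc n) * (1 + \<beta> * real n) * norm2 n < 0"
      using assms[of n] norm2_nonneg[of n] by (intro mult_neg_pos mult_pos_neg) auto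
    then show False using norm2_nonneg[of "Suc n"] unfolding norm2_Suc by simp
  qed
  moreover have "\<alpha> \<noteq> 0 \<or> \<alpha> = 0 \<and> \<beta> = 0" using degenerate by blast
  ultimately show ?thesis
    unfolding meixner_ML_infinite_def moments1_def
    using szego_jacobi[of \<infinity>] borel moments prob_space_axioms
    by (intro conjI exI[of _ \<alpha>] exI[of _ 0] exI[of _ \<beta>] exI[of _ 1]) auto
qed

text \<open>The least \<open>k\<close> of vanishing norm is the number of support points: the
  support lies among the roots of \<open>p k\<close>, and fewer points would give a vanishing norm
  in a smaller degree. Vanishing at \<open>k\<close> but not at \<open>k - 1\<close> forces
  \<open>1 + \<beta> * (k - 1) = 0\<close>, which is the required relation with
  \<open>t = 1\<close>; hence \<open>\<beta>\<close>, and by \<open>degenerate\<close> also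
  \<open>\<alpha>\<close>, is nonzero.\<close>

lemma meixner_finite:
  assumes "norm2 n = 0"
  shows "meixner_ML_finite M"
proof -
  define k where "k = (LEAST k. norm2 k = 0)"
  have k: "norm2 k = 0" and least: "\<And>j. norm2 j = 0 \<Longrightarrow> k \<le> j"
    unfolding k_def using assms by (auto intro: LeastI Least_le)
  have "norm2 1 = 1" using norm2_Suc[of 0] by (simp add: norm2_0)
  then have k2: "k \<ge> 2" using k norm2_0 by (metis One_nat_def less_2_cases not_le zero_neq_one)
  obtain l where l: "k = Suc l" using k2 by (cases k) auto
  have "norm2 l \<noteq> 0" using least[of l] l by auto
  then have \<beta>: "1 + \<beta> * real l = 0" using k unfolding l norm2_Suc by simp
  define R where "R = {x. poly (p k) x = 0}"
  have R: "finite R" "card R \<le> k"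
    using poly_roots_finite[OF monic(3)[of k]] card_poly_roots_bound[OF monic(3)[of k]] monic(1)[of k]
    by (simp_all add: R_def)
  have sub: "msupport M \<subseteq> R"
  proof
    fix x assume x: "x \<in> msupport M"
    have "open (- R)" using R(1) by (simp add: finite_imp_closed open_Compl)
    moreover have "emeasure M (- R) = 0"
    proof -
      have "AE x in M. x \<notin> - R" using k unfolding norm2_eq_0_iff by (simp add: R_def)
      then show ?thesis using \<open>open (- R)\<close> borel by (subst (asm) AE_iff_null_sets[symmetric]) auto
    qed
    ultimately show "x \<in> R" using x unfolding msupport_def by blast
  qed
  then have fin: "finite (msupport M)" using R(1) finite_subset by blast
  have "card (msupport M) = k"
    using card_mono[OF R(1) sub] R(2) least[OF norm2_card_msupport[OF fin]] by simp
  moreover have "\<beta> \<noteq> 0" "1 = - \<beta> * (real k - 1)" using \<beta> l by auto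
  moreover have "\<alpha> \<noteq> 0" using degenerate \<open>\<beta> \<noteq> 0\<close> by blast
  ultimately show ?thesis
    unfolding meixner_ML_finite_def moments1_def
    using szego_jacobi[of "enat k"] borel moments prob_space_axioms fin k2
    by (intro conjI exI[of _ k] exI[of _ \<alpha>] exI[of _ 0] exI[of _ \<beta>] exI[of _ 1]) auto
qed

lemma meixner: "meixner_ML M"
  using meixner_finite meixner_infinite unfolding meixner_ML_def by blast

end

section \<open>Polynomial functions on the plane\<close>

instantiation "fun" :: (type, real_vector) real_vector
begin

definition scaleR_fun :: "real \<Rightarrow> ('a \<Rightarrow> 'b) \<Rightarrow> 'a \<Rightarrow> 'b" where
  "scaleR_fun r f = (\<lambda>x. r *\<^sub>R f x)"

instance
  by standard (simp_all add: scaleR_fun_def fun_eq_iff scaleR_add_right scaleR_add_left)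

end

lemma scaleR_fun_apply [simp]: "(r *\<^sub>R f) x = r *\<^sub>R f x"
  by (simp add: scaleR_fun_def)

lemma sum_fun_apply: "(\<Sum>i\<in>I. f i) x = (\<Sum>i\<in>I. f i x)"
  by (induction I rule: infinite_finite_induct) auto

lemma minus_fun_apply' [simp]: "(f - g) x = f x - g x" for f g :: "'a \<Rightarrow> real"
  by (simp add: fun_diff_def)

definition monomial :: "nat \<Rightarrow> nat \<Rightarrow> real \<times> real \<Rightarrow> real" where
  "monomial i j = (\<lambda>(x, y). x ^ i * y ^ j)"

lemma polys_le_span: "polys_le n = span {monomial i j | i j. i + j \<le> n}"
proof
  show "polys_le n \<subseteq> span {monomial i j | i j. i + j \<le> n}"
  proof
    fix f assume "f \<in> polys_le n"
    then obtain c where "f = (\<lambda>(x, y). \<Sum>i\<le>n. \<Sum>j\<le>n - i. c i j * x ^ i * y ^ j)"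
      by (auto simp: polys_le_def)
    then have "f = (\<Sum>i\<le>n. \<Sum>j\<le>n - i. c i j *\<^sub>R monomial i j)"
      by (auto simp: fun_eq_iff sum_fun_apply monomial_def mult_ac)
    then show "f \<in> span {monomial i j | i j. i + j \<le> n}"
      by (simp only:, intro span_sum span_scale span_base CollectI exI conjI refl) auto
  qed
  show "span {monomial i j | i j. i + j \<le> n} \<subseteq> polys_le n"
  proof (rule span_minimal)
    show "{monomial i j | i j. i + j \<le> n} \<subseteq> polys_le n"
    proof safe
      fix k l assume kl: "k + l \<le> n"
      define c where "c i j = (if i = k then if j = l then 1 else 0 else 0 :: real)" for i j
      have "(\<Sum>i\<le>n. \<Sum>j\<le>n - i. c i j * x ^ i * y ^ j) = x ^ k * y ^ l" for x y
      proof -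
        have e: "c i j * x ^ i * y ^ j = (if i = k then if j = l then x ^ k * y ^ l else 0 else 0)"
          for i j by (simp add: c_def)
        have "(\<Sum>i\<le>n. \<Sum>j\<le>n - i. c i j * x ^ i * y ^ j)
          = (\<Sum>i\<le>n. if i = k then (\<Sum>j\<le>n - k. if j = l then x ^ k * y ^ l else 0) else 0)"
          unfolding e by (intro sum.cong refl) auto
        then show ?thesis using kl by simp
      qed
      then have "monomial k l = (\<lambda>(x, y). \<Sum>i\<le>n. \<Sum>j\<le>n - i. c i j * x ^ i * y ^ j)"
        by (auto simp: monomial_def)
      then show "monomial k l \<in> polys_le n" unfolding polys_le_def by blast
    qed
    show "subspace (polys_le n)"
      unfolding subspace_def
    proof (intro conjI allI ballI)
      show "0 \<in> polys_le n"
        by (auto simp: polys_le_def fun_eq_iff intro!: exI[of _ "\<lambda>_ _. 0"])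
      fix f assume "f \<in> polys_le n"
      then obtain c where c: "f = (\<lambda>(x, y). \<Sum>i\<le>n. \<Sum>j\<le>n - i. c i j * x ^ i * y ^ j)"
        by (auto simp: polys_le_def)
      show "r *\<^sub>R f \<in> polys_le n" for r
        by (auto simp: c polys_le_def fun_eq_iff sum_distrib_left mult.assoc
            intro!: exI[of _ "\<lambda>i j. r * c i j"])
      fix g assume "g \<in> polys_le n"
      then obtain d where d: "g = (\<lambda>(x, y). \<Sum>i\<le>n. \<Sum>j\<le>n - i. d i j * x ^ i * y ^ j)"
        by (auto simp: polys_le_def)
      show "f + g \<in> polys_le n"
        by (auto simp: c d polys_le_def fun_eq_iff sum.distrib algebra_simps
            intro!: exI[of _ "\<lambda>i j. c i j + d i j"])
    qed
  qed
qed

lemma polys_le_mono: "m \<le> n \<Longrightarrow> polys_le m \<subseteq> polys_le n"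
  unfolding polys_le_span by (intro span_mono) (blast intro: le_trans)

lemma polys_span: "polys = span (range (\<lambda>(i, j). monomial i j))"
proof
  show "polys \<subseteq> span (range (\<lambda>(i, j). monomial i j))"
    unfolding polys_def polys_le_span by (intro UN_least span_mono) auto
  show "span (range (\<lambda>(i, j). monomial i j)) \<subseteq> polys"
  proof
    fix f assume "f \<in> span (range (\<lambda>(i, j). monomial i j))"
    then show "f \<in> polys"
    proof (induction rule: span_induct_alt)
      case base
      show ?case unfolding polys_def polys_le_span using span_zero by blast
    next
      case (step c x y)
      then obtain i j n where x: "x = monomial i j" and y: "y \<in> polys_le n"
        by (auto simp: polys_def)
      have "y \<in> polys_le (i + j + n)"
        using y polys_le_mono[of n "i + j + n"] by auto
      moreover have "x \<in> polys_le (i + j + n)"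
        unfolding polys_le_span x by (rule span_base, intro CollectI exI[of _ i] exI[of _ j]) simp
      ultimately have "c *\<^sub>R x + y \<in> polys_le (i + j + n)"
        unfolding polys_le_span by (intro span_add span_scale)
      then show ?case unfolding polys_def by blast
    qed
  qed
qed

lemma subspace_polys: "subspace polys"
  unfolding polys_span by (rule subspace_span)

lemmas polys_0 = subspace_0[OF subspace_polys]
  and polys_add = subspace_add[OF subspace_polys]
  and polys_diff = subspace_diff[OF subspace_polys]
  and polys_scale = subspace_scale[OF subspace_polys]

lemma monomial_polys: "monomial i j \<in> polys"
  unfolding polys_span by (rule span_base) auto

lemma one_eq_monomial: "(1 :: real \<times> real \<Rightarrow> real) = monomial 0 0"
  by (auto simp: monomial_def)

lemma polys_1: "1 \<in> polys"
  unfolding one_eq_monomial by (rule monomial_polys)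

lemma polys_mult: "f \<in> polys \<Longrightarrow> g \<in> polys \<Longrightarrow> f * g \<in> polys"
proof -
  have 1: "monomial i j * g \<in> polys" if "g \<in> polys" for g i j
    using that unfolding polys_span
  proof (induction rule: span_induct_alt)
    case base
    have "monomial i j * 0 = 0" by (simp add: fun_eq_iff)
    then show ?case using span_zero by metis
  next
    case (step c x y)
    then obtain k l where "x = monomial k l" by auto
    then have eq: "monomial i j * (c *\<^sub>R x + y) = c *\<^sub>R monomial (i + k) (j + l) + monomial i j * y"
      by (auto simp: fun_eq_iff monomial_def power_add algebra_simps)
    show ?case
      unfolding eq by (intro span_add span_scale step.IH monomial_polys[unfolded polys_span])
  qed
  show "f * g \<in> polys" if "f \<in> polys" "g \<in> polys"
    using that(1) unfolding polys_span
  proof (induction rule: span_induct_alt)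
    case base
    have "0 * g = 0" by (simp add: fun_eq_iff)
    then show ?case using span_zero by metis
  next
    case (step c x y)
    have "x * g \<in> polys" using step 1[OF that(2)] by auto
    have eq: "(c *\<^sub>R x + y) * g = c *\<^sub>R (x * g) + y * g"
      by (auto simp: fun_eq_iff algebra_simps)
    show ?case
      unfolding eq using step.IH \<open>x * g \<in> polys\<close> unfolding polys_span
      by (intro span_add span_scale)
  qed
qed

lemma fst_polys: "fst \<in> polys" and snd_polys: "snd \<in> polys"
proof -
  have "fst = monomial 1 0" "snd = monomial 0 1" by (auto simp: monomial_def fun_eq_iff)
  then show "fst \<in> polys" "snd \<in> polys" by (metis monomial_polys)+
qed

section \<open>Polynomial functions modulo equality almost everywhere\<close>

locale plane_measure = prob_space \<mu> for \<mu> :: "(real \<times> real) measure" +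
  assumes borel [measurable_cong]: "sets \<mu> = sets borel" and moments: "moments2 \<mu>"
begin

lemma integrable_polys: "f \<in> polys \<Longrightarrow> integrable \<mu> f"
  unfolding polys_span
proof (induction rule: span_induct_alt)
  case base
  then show ?case by (simp add: zero_fun_def)
next
  case (step c x y)
  then obtain i j where "x = monomial i j" by auto
  then have "integrable \<mu> x" using moments by (simp add: moments2_def monomial_def)
  then show ?case using step by (simp add: plus_fun_def)
qed

lemma polys_measurable: "f \<in> polys \<Longrightarrow> f \<in> borel_measurable \<mu>"
  using integrable_polys by blast

lemma integrable_mult_polys: "f \<in> polys \<Longrightarrow> g \<in> polys \<Longrightarrow> integrable \<mu> (\<lambda>z. f z * g z)"
  using integrable_polys[OF polys_mult[of f g]] by (simp add: times_fun_def)

definition null_polys :: "(real \<times> real \<Rightarrow> real) set" where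
  "null_polys = {f \<in> polys. AE z in \<mu>. f z = 0}"

lemma subspace_null_polys: "subspace null_polys"
  unfolding subspace_def null_polys_def
  by (auto intro: polys_0 polys_add polys_scale)

text \<open>A linear choice of one representative in each class: on its range, equality is equality of
  classes, and operators on classes become genuine linear maps.\<close>

definition projection :: "((real \<times> real \<Rightarrow> real) \<Rightarrow> (real \<times> real \<Rightarrow> real)) \<Rightarrow> bool" where
  "projection P \<longleftrightarrow> linear P \<and> (\<forall>f. P f \<in> polys \<and> P (P f) = P f)
     \<and> (\<forall>f\<in>polys. AE z in \<mu>. P f z = f z) \<and> (\<forall>f\<in>null_polys. P f = 0)"

text \<open>With \<open>p\<close> a linear projection of all functions onto \<open>polys\<close> and
  \<open>q\<close> one onto \<open>null_polys\<close>, subtracting \<open>q\<close> after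
  \<open>p\<close> changes a polynomial only by a null polynomial and sends every null polynomial to
  0.\<close>

lemma projection_exists: "\<exists>P. projection P"
proof -
  have *: "\<exists>g. g ` UNIV \<subseteq> V \<and> linear g \<and> (\<forall>v\<in>V. g v = v)" if "subspace V" for V :: "(real \<times> real \<Rightarrow> real) set"
    using linear_exists_left_inverse_on[of "\<lambda>v. v" V] that by (simp add: linear_ident)
  obtain p where p: "range p \<subseteq> polys" "linear p" "\<And>v. v \<in> polys \<Longrightarrow> p v = v"
    using *[OF subspace_polys] by blast
  obtain q where q: "range q \<subseteq> null_polys" "linear q" "\<And>v. v \<in> null_polys \<Longrightarrow> q v = v"
    using *[OF subspace_null_polys] by blast
  have pp: "p f \<in> polys" for f using p(1) by auto
  have qq: "q f \<in> null_polys" for f using q(1) by auto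
  have np: "null_polys \<subseteq> polys" by (auto simp: null_polys_def)
  define P where "P f = p f - q (p f)" for f
  have "linear P"
    unfolding P_def using linear_compose[OF p(2) q(2)] by (intro linear_compose_sub p(2)) (simp add: o_def)
  moreover have P: "P f \<in> polys" for f
    unfolding P_def using pp qq np by (intro polys_diff) auto
  moreover have "P (P f) = P f" for f
  proof -
    have "p (P f) = P f" using P p(3) by blast
    moreover have "q (P f) = 0" unfolding P_def using linear_diff[OF q(2)] q(3)[OF qq] by simp
    ultimately show ?thesis unfolding P_def by simp
  qed
  moreover have "AE z in \<mu>. P f z = f z" if "f \<in> polys" for f
  proof -
    have "AE z in \<mu>. q f z = 0" using qq[of f] by (simp add: null_polys_def)
    then show ?thesis unfolding P_def p(3)[OF that] by eventually_elim simp
  qed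
  moreover have "P f = 0" if "f \<in> null_polys" for f
    unfolding P_def using that np q(3) p(3) by auto
  ultimately show ?thesis unfolding projection_def by blast
qed

definition P :: "(real \<times> real \<Rightarrow> real) \<Rightarrow> (real \<times> real \<Rightarrow> real)" where
  "P = (SOME P. projection P)"

lemma projection_P: "projection P"
  unfolding P_def using projection_exists by (rule someI_ex)

lemma linear_P: "linear P" and P_polys: "P f \<in> polys" and P_idem: "P (P f) = P f"
  and P_AE: "f \<in> polys \<Longrightarrow> AE z in \<mu>. P f z = f z"
  and P_null: "f \<in> null_polys \<Longrightarrow> P f = 0"
  using projection_P unfolding projection_def by auto

lemmas P_add = linear_add[OF linear_P] and P_diff = linear_diff[OF linear_P]
  and P_scale = linear_cmul[OF linear_P] and P_0 = linear_0[OF linear_P]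

lemma P_eqI:
  assumes "f \<in> polys" "g \<in> polys" "AE z in \<mu>. f z = g z"
  shows "P f = P g"
proof -
  have "f - g \<in> null_polys" using assms by (auto simp: null_polys_def intro: polys_diff)
  then have "P f - P g = 0" using P_null P_diff by metis
  then show ?thesis by simp
qed

text \<open>Passing to representatives makes the form bilinear on all functions, where the bare
  integral of a product need not be additive.\<close>

definition ip :: "(real \<times> real \<Rightarrow> real) \<Rightarrow> (real \<times> real \<Rightarrow> real) \<Rightarrow> real" where
  "ip f g = (\<integral>z. P f z * P g z \<partial>\<mu>)"

lemma ip_polys: "f \<in> polys \<Longrightarrow> g \<in> polys \<Longrightarrow> ip f g = (\<integral>z. f z * g z \<partial>\<mu>)"
  unfolding ip_def using P_AE[of f] P_AE[of g]
  by (intro integral_cong_AE) (auto intro: polys_measurable borel_measurable_times P_polys)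

lemma bilinear_ip: "bilinear ip"
  unfolding bilinear_def linear_iff ip_def
  by (auto simp: P_add P_scale algebra_simps integrable_mult_polys P_polys)

lemma ip_nonneg: "0 \<le> ip f f"
  unfolding ip_def by (intro integral_nonneg_AE) simp

lemma ip_eq_0: "ip f f = 0 \<Longrightarrow> P f = 0"
proof -
  assume "ip f f = 0"
  then have "AE z in \<mu>. P f z = 0"
    unfolding ip_def
    by (subst (asm) integral_nonneg_eq_0_iff_AE) (auto simp: integrable_mult_polys P_polys)
  then have "P (P f) = 0" by (intro P_null) (auto simp: null_polys_def P_polys)
  then show ?thesis by (simp add: P_idem)
qed

text \<open>\<open>is_operator\<close> grants linearity only on \<open>polys\<close> and almost
  everywhere. The inner \<open>P\<close> brings the argument into \<open>polys\<close>, the outer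
  one turns equality almost everywhere into equality.\<close>

lemma linear_lift: "is_operator \<mu> A \<Longrightarrow> linear (\<lambda>f. P (A (P f)))"
proof (rule linearI)
  assume A: "is_operator \<mu> A"
  show "P (A (P (f + g))) = P (A (P f)) + P (A (P g))" for f g
    unfolding P_add[symmetric] unfolding P_add[of f g] using A P_polys
    by (intro P_eqI) (auto simp: is_operator_def ae_eq_def plus_fun_def intro!: polys_add[unfolded plus_fun_def])
  show "P (A (P (r *\<^sub>R f))) = r *\<^sub>R P (A (P f))" for f r
    unfolding P_scale[symmetric] unfolding P_scale[of r f] using A P_polys
    by (intro P_eqI) (auto simp: is_operator_def ae_eq_def scaleR_fun_def intro!: polys_scale[unfolded scaleR_fun_def real_scaleR_def])
qed

lemma lift_P: "is_operator \<mu> A \<Longrightarrow> f \<in> polys \<Longrightarrow> P (A (P f)) = P (A f)"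
  using P_polys P_AE by (intro P_eqI) (auto simp: is_operator_def ae_eq_def)

section \<open>The degree filtration and its orthogonal grading\<close>

lemma subspace_polys_le: "subspace (polys_le n)"
  unfolding polys_le_span by (rule subspace_span)

lemma F_mono: "m \<le> n \<Longrightarrow> F \<mu> m \<subseteq> F \<mu> n"
  unfolding F_def using polys_le_mono by blast

lemma subspace_F: "subspace (F \<mu> n)"
  unfolding subspace_def
proof (intro conjI allI ballI)
  show "0 \<in> F \<mu> n"
    unfolding F_def ae_eq_def using polys_0 subspace_0[OF subspace_polys_le, of n]
    by (intro CollectI conjI bexI[of _ 0]) auto
  fix f assume f: "f \<in> F \<mu> n"
  then obtain p where p: "p \<in> polys_le n" "AE z in \<mu>. f z = p z" "f \<in> polys"
    by (auto simp: F_def ae_eq_def)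
  have "AE z in \<mu>. (r *\<^sub>R f) z = (r *\<^sub>R p) z" for r using p(2) by eventually_elim simp
  then show "r *\<^sub>R f \<in> F \<mu> n" for r
    unfolding F_def ae_eq_def using p subspace_scale[OF subspace_polys_le] polys_scale by blast
  fix g assume g: "g \<in> F \<mu> n"
  then obtain q where q: "q \<in> polys_le n" "AE z in \<mu>. g z = q z" "g \<in> polys"
    by (auto simp: F_def ae_eq_def)
  have "AE z in \<mu>. (f + g) z = (p + q) z" using p(2) q(2) by eventually_elim simp
  then show "f + g \<in> F \<mu> n"
    unfolding F_def ae_eq_def using p q subspace_add[OF subspace_polys_le] polys_add by blast
qed

lemma F_polys: "F \<mu> n \<subseteq> polys"
  by (auto simp: F_def)

lemma G_polys: "G \<mu> n \<subseteq> polys"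
  using F_polys by (auto simp: G_def)

lemma subspace_G: "subspace (G \<mu> n)"
proof -
  consider "n < 0" | "n = 0" | "n > 0" by linarith
  then show ?thesis
  proof cases
    case 1
    then show ?thesis using subspace_null_polys by (simp add: G_def null_polys_def ae_eq_def)
  next
    case 2
    then show ?thesis using subspace_F by (simp add: G_def)
  next
    case 3
    have "inner_L2 \<mu> (f + g) h = inner_L2 \<mu> f h + inner_L2 \<mu> g h"
      if "f \<in> polys" "g \<in> polys" "h \<in> polys" for f g h
      using that by (simp add: inner_L2_def distrib_right integrable_mult_polys)
    moreover have "inner_L2 \<mu> (r *\<^sub>R f) h = r * inner_L2 \<mu> f h" for f h r
      by (simp add: inner_L2_def mult.assoc)
    moreover have "inner_L2 \<mu> 0 h = 0" for h by (simp add: inner_L2_def)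
    ultimately show ?thesis
      using 3 subspace_F[of "nat n"] F_polys
      unfolding subspace_def G_def by (auto simp: subset_iff)
  qed
qed

definition Gr :: "int \<Rightarrow> (real \<times> real \<Rightarrow> real) set" where
  "Gr n = P ` G \<mu> n"

lemma subspace_Gr: "subspace (Gr n)"
  unfolding Gr_def by (intro linear_subspace_image linear_P subspace_G)

lemma Gr_neg: "n < 0 \<Longrightarrow> Gr n = {0}"
proof -
  assume "n < 0"
  then have "G \<mu> n = null_polys" by (auto simp: G_def null_polys_def ae_eq_def)
  then show ?thesis
    unfolding Gr_def using P_null subspace_0[OF subspace_null_polys] by (auto simp: image_iff)
qed

lemma Gr_0: "Gr 0 = range (\<lambda>r. r *\<^sub>R P 1)"
proof -
  have c: "polys_le 0 = range (\<lambda>r. r *\<^sub>R 1)"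
  proof -
    have "{monomial i j | i j. i + j \<le> 0} = {1}" by (auto simp: one_eq_monomial)
    then show ?thesis unfolding polys_le_span by (simp add: span_singleton)
  qed
  have G: "G \<mu> 0 = F \<mu> 0" by (simp add: G_def)
  show ?thesis
  proof
    show "Gr 0 \<subseteq> range (\<lambda>r. r *\<^sub>R P 1)"
    proof
      fix f assume "f \<in> Gr 0"
      then obtain g r where g: "f = P g" "g \<in> polys" "AE z in \<mu>. g z = (r *\<^sub>R 1) z"
        unfolding Gr_def G F_def c ae_eq_def by blast
      have "P g = P (r *\<^sub>R 1)" by (intro P_eqI polys_scale polys_1 g)
      then have "f = r *\<^sub>R P 1" by (simp only: g(1) P_scale)
      then show "f \<in> range (\<lambda>r. r *\<^sub>R P 1)" by blast
    qed
    have "r *\<^sub>R 1 \<in> F \<mu> 0" for r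
      unfolding F_def c ae_eq_def using polys_scale[OF polys_1] by blast
    then have "P (r *\<^sub>R 1) \<in> Gr 0" for r unfolding Gr_def G by blast
    then show "range (\<lambda>r. r *\<^sub>R P 1) \<subseteq> Gr 0" by (auto simp: P_scale)
  qed
qed

lemma Gr_orth_less:
  assumes "m < n" "f \<in> Gr m" "g \<in> Gr n"
  shows "ip f g = 0"
proof -
  obtain f' g' where f': "f = P f'" "f' \<in> G \<mu> m" and g': "g = P g'" "g' \<in> G \<mu> n"
    using assms unfolding Gr_def by blast
  show ?thesis
  proof (cases "m < 0")
    case True
    then show ?thesis using Gr_neg assms(2) by (simp add: ip_def P_0)
  next
    case False
    then have "f' \<in> F \<mu> (nat m)" using f'(2) by (auto simp: G_def split: if_splits)
    moreover have "nat m \<le> nat n - 1" using assms(1) False by linarith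
    ultimately have "f' \<in> F \<mu> (nat n - 1)" using F_mono by blast
    then have "inner_L2 \<mu> g' f' = 0"
      using g'(2) assms(1) False by (simp add: G_def)
    moreover have "ip f g = ip f' g'" unfolding f' g' by (simp add: ip_def P_idem)
    moreover have "f' \<in> polys" "g' \<in> polys" using f' g' G_polys by blast+
    ultimately show ?thesis by (simp add: ip_polys inner_L2_def mult.commute)
  qed
qed

lemma ip_commute: "ip f g = ip g f"
  by (simp add: ip_def mult.commute)

lemma Gr_orth: "m \<noteq> n \<Longrightarrow> f \<in> Gr m \<Longrightarrow> g \<in> Gr n \<Longrightarrow> ip f g = 0"
  using Gr_orth_less ip_commute by (metis linorder_neqE)

lemma lift_Gr:
  assumes "is_operator \<mu> A" "\<And>k f. f \<in> G \<mu> (int k) \<Longrightarrow> A f \<in> G \<mu> (int k + d)" "f \<in> Gr n"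
  shows "P (A (P f)) \<in> Gr (n + d)"
\<comment> \<open>The hypothesis on \<open>A\<close> covers natural degrees only; in negative
  degrees the graded space is trivial.\<close>
proof (cases "n < 0")
  case True
  then have "P (A (P f)) = 0"
    using Gr_neg[of n] assms(3) linear_0[OF linear_lift[OF assms(1)]] by simp
  then show ?thesis using subspace_0[OF subspace_Gr] by simp
next
  case False
  obtain g where g: "f = P g" "g \<in> G \<mu> n" using assms(3) unfolding Gr_def by blast
  have "P (A (P f)) = P (A g)"
    unfolding g(1) P_idem using g(2) G_polys by (intro lift_P assms(1)) blast
  moreover have "A g \<in> G \<mu> (n + d)" using assms(2)[of g "nat n"] g(2) False by simp
  ultimately show ?thesis unfolding Gr_def by blast
qed

end

section \<open>Commutation relations\<close>

text \<open>The algebraic content of the problem: \<open>X u\<close> stands for multiplication by a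
  centred linear form and \<open>\<Omega>\<close> for the constant 1. \<open>cyclic\<close>
  expresses that multiplication generates all polynomials from 1, \<open>nondegenerate\<close> that
  no line carries the measure, and \<open>closed\<close> is the Lie algebra hypothesis with
  \<open>P\<close> as identity. The space of directions is left abstract; dimension two enters only
  through a choice of basis.\<close>

locale fock =
  fixes P :: "'v::real_vector \<Rightarrow> 'v" and ip :: "'v \<Rightarrow> 'v \<Rightarrow> real" and \<Omega> :: 'v
    and Gr :: "int \<Rightarrow> 'v set" and am a0 ap :: "'u::real_vector \<Rightarrow> 'v \<Rightarrow> 'v"
    and X :: "'u \<Rightarrow> 'v \<Rightarrow> 'v"
  assumes linear_P: "linear P" and P_idem: "P (P f) = P f"
    and bilinear_ip: "bilinear ip" and ip_commute: "ip f g = ip g f"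
    and ip_P: "ip (P f) g = ip f g" and ip_nonneg: "0 \<le> ip f f"
    and ip_eq_0: "ip f f = 0 \<Longrightarrow> P f = 0"
    and subspace_Gr: "subspace (Gr n)" and P_Gr: "f \<in> Gr n \<Longrightarrow> P f = f"
    and Gr_neg: "n < 0 \<Longrightarrow> Gr n = {0}" and Gr_0: "Gr 0 = range (\<lambda>r. r *\<^sub>R \<Omega>)"
    and ip_vacuum: "ip \<Omega> \<Omega> = 1"
    and Gr_orth: "m \<noteq> n \<Longrightarrow> f \<in> Gr m \<Longrightarrow> g \<in> Gr n \<Longrightarrow> ip f g = 0"
    and linear_index: "linear (\<lambda>u. am u f)" "linear (\<lambda>u. a0 u f)" "linear (\<lambda>u. ap u f)"
    and linear_op: "linear (am u)" "linear (a0 u)" "linear (ap u)"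
    and op_P: "am u (P f) = am u f" "a0 u (P f) = a0 u f" "ap u (P f) = ap u f"
    and P_op: "P (am u f) = am u f" "P (a0 u f) = a0 u f" "P (ap u f) = ap u f"
    and am_Gr: "f \<in> Gr n \<Longrightarrow> am u f \<in> Gr (n - 1)"
    and a0_Gr: "f \<in> Gr n \<Longrightarrow> a0 u f \<in> Gr n"
    and ap_Gr: "f \<in> Gr n \<Longrightarrow> ap u f \<in> Gr (n + 1)"
    and X_eq: "X u f = am u f + a0 u f + ap u f"
    and X_commute: "X u (X v f) = X v (X u f)"
    and X_sym: "ip (X u f) g = ip f (X u g)"
    and cyclic: "subspace S \<Longrightarrow> \<Omega> \<in> S \<Longrightarrow> (\<And>u f. f \<in> S \<Longrightarrow> X u f \<in> S) \<Longrightarrow> P f \<in> S"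
    and closed: "A \<in> {am, a0, ap} \<Longrightarrow> B \<in> {am, a0, ap} \<Longrightarrow>
      \<exists>w w' w'' c. \<forall>f. A u (B v f) - B v (A u f) = am w f + a0 w' f + ap w'' f + c *\<^sub>R P f"
    and centered: "ip (X u \<Omega>) \<Omega> = 0"
    and nondegenerate: "ip (X u \<Omega>) (X u \<Omega>) = 0 \<Longrightarrow> u = 0"
begin

lemma ip_linear [simp]:
  "ip (f + f') g = ip f g + ip f' g" "ip (f - f') g = ip f g - ip f' g"
  "ip (r *\<^sub>R f) g = r * ip f g" "ip (- f) g = - ip f g" "ip 0 g = 0"
  "ip g (f + f') = ip g f + ip g f'" "ip g (f - f') = ip g f - ip g f'"
  "ip g (r *\<^sub>R f) = r * ip g f" "ip g (- f) = - ip g f" "ip g 0 = 0"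
  using bilinear_ip
  by (auto simp: bilinear_ladd bilinear_radd bilinear_lsub bilinear_rsub bilinear_lmul
      bilinear_rmul bilinear_lneg bilinear_rneg bilinear_lzero bilinear_rzero)

lemma ip_sum: "ip (sum v I) g = (\<Sum>i\<in>I. ip (v i) g)"
  by (induction I rule: infinite_finite_induct) auto

lemma op_linear [simp]:
  "am u (f + g) = am u f + am u g" "am u (f - g) = am u f - am u g"
  "am u (r *\<^sub>R f) = r *\<^sub>R am u f" "am u 0 = 0"
  "a0 u (f + g) = a0 u f + a0 u g" "a0 u (f - g) = a0 u f - a0 u g"
  "a0 u (r *\<^sub>R f) = r *\<^sub>R a0 u f" "a0 u 0 = 0"
  "ap u (f + g) = ap u f + ap u g" "ap u (f - g) = ap u f - ap u g"
  "ap u (r *\<^sub>R f) = r *\<^sub>R ap u f" "ap u 0 = 0"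
  "P (f + g) = P f + P g" "P (f - g) = P f - P g"
  "P (r *\<^sub>R f) = r *\<^sub>R P f" "P 0 = 0"
  by (simp_all add: linear_op linear_P linear_add linear_diff linear_cmul linear_0)

lemma index_linear:
  "am (u + v) f = am u f + am v f" "am (u - v) f = am u f - am v f" "am (r *\<^sub>R u) f = r *\<^sub>R am u f"
  "a0 (u + v) f = a0 u f + a0 v f" "a0 (u - v) f = a0 u f - a0 v f" "a0 (r *\<^sub>R u) f = r *\<^sub>R a0 u f"
  "ap (u + v) f = ap u f + ap v f" "ap (u - v) f = ap u f - ap v f" "ap (r *\<^sub>R u) f = r *\<^sub>R ap u f"
  using linear_index[of f] by (auto dest: linear_add linear_diff linear_cmul)

lemma index_0 [simp]: "am 0 f = 0" "a0 0 f = 0" "ap 0 f = 0"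
  using linear_index[of f] by (auto dest: linear_0)

lemma vacuum_Gr: "\<Omega> \<in> Gr 0"
  unfolding Gr_0 by (metis rangeI scaleR_one)

lemma P_vacuum [simp]: "P \<Omega> = \<Omega>"
  using P_Gr vacuum_Gr by blast

text \<open>Pairing the sum with \<open>v j\<close> leaves the square norm of \<open>v j\<close>.
  The form is only semidefinite, but elements of \<open>Gr\<close> are fixed by \<open>P\<close>,
  and \<open>P\<close> kills vectors of norm zero.\<close>

lemma graded_independent:
  assumes "finite I" "\<And>i. i \<in> I \<Longrightarrow> v i \<in> Gr (n + i)" "sum v I = 0" "j \<in> I"
  shows "v j = 0"
proof -
  have "0 = ip (sum v I) (v j)" using assms by simp
  also have "\<dots> = (\<Sum>i\<in>I. if i = j then ip (v j) (v j) else 0)"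
    unfolding ip_sum using assms(2,4) by (intro sum.cong refl) (auto intro: Gr_orth[of "n + _" "n + j"])
  also have "\<dots> = ip (v j) (v j)" using assms by simp
  finally have "P (v j) = 0" by (intro ip_eq_0) simp
  then show ?thesis using P_Gr assms(2,4) by metis
qed

text \<open>The clause \<open>A (P f) = A f\<close> makes \<open>A\<close> act on classes, so that
  its values on the graded spaces determine it.\<close>

definition hom :: "int \<Rightarrow> ('v \<Rightarrow> 'v) \<Rightarrow> bool" where
  "hom d A \<longleftrightarrow> linear A \<and> (\<forall>f. A (P f) = A f) \<and> (\<forall>n. \<forall>f\<in>Gr n. A f \<in> Gr (n + d))"

lemma Gr_closed:
  "f \<in> Gr n \<Longrightarrow> g \<in> Gr n \<Longrightarrow> f + g \<in> Gr n" "f \<in> Gr n \<Longrightarrow> g \<in> Gr n \<Longrightarrow> f - g \<in> Gr n"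
  "f \<in> Gr n \<Longrightarrow> r *\<^sub>R f \<in> Gr n" "f \<in> Gr n \<Longrightarrow> - f \<in> Gr n" "0 \<in> Gr n"
  using subspace_Gr[of n]
  by (auto intro: subspace_add subspace_diff subspace_scale subspace_neg subspace_0)

lemma hom_intros:
  "hom (-1) (am u)" "hom 0 (a0 u)" "hom 1 (ap u)" "hom 0 P" "hom d (\<lambda>_. 0)"
  "hom d A \<Longrightarrow> hom d B \<Longrightarrow> hom d (\<lambda>f. A f + B f)"
  "hom d A \<Longrightarrow> hom d B \<Longrightarrow> hom d (\<lambda>f. A f - B f)"
  "hom d A \<Longrightarrow> hom d (\<lambda>f. r *\<^sub>R A f)" "hom d A \<Longrightarrow> hom d (\<lambda>f. - A f)"
  unfolding hom_def
  using am_Gr a0_Gr ap_Gr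
  by (auto intro: linear_op linear_P linear_compose_add linear_compose_sub linear_zero
      linear_compose_neg linear_compose_scale_right Gr_closed
      simp: op_P P_idem P_Gr)

lemma hom_compose: "hom d A \<Longrightarrow> hom e B \<Longrightarrow> hom (d + e) (\<lambda>f. A (B f))"
  unfolding hom_def using linear_compose[of B A]
  by (auto simp: o_def add.assoc[symmetric] add.commute[of d])

definition comm :: "('v \<Rightarrow> 'v) \<Rightarrow> ('v \<Rightarrow> 'v) \<Rightarrow> 'v \<Rightarrow> 'v" where
  "comm A B = (\<lambda>f. A (B f) - B (A f))"

lemma hom_comm: "hom d A \<Longrightarrow> hom e B \<Longrightarrow> k = d + e \<Longrightarrow> hom k (comm A B)"
  unfolding comm_def using hom_compose[of d A e B] hom_compose[of e B d A]
  by (auto intro: hom_intros simp: add.commute)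

lemma P_in_span_Gr: "P f \<in> span (\<Union>n. Gr n)"
proof (rule cyclic)
  show "\<Omega> \<in> span (\<Union>n. Gr n)" using vacuum_Gr by (auto intro: span_base)
  fix u f assume "f \<in> span (\<Union>n. Gr n)"
  then show "X u f \<in> span (\<Union>n. Gr n)"
  proof (induction rule: span_induct_alt)
    case base
    then show ?case by (simp add: X_eq span_zero)
  next
    case (step c x y)
    then obtain n where n: "x \<in> Gr n" by auto
    have "X u x \<in> span (\<Union>n. Gr n)"
      unfolding X_eq using am_Gr[OF n] a0_Gr[OF n] ap_Gr[OF n]
      by (intro span_add span_base) auto
    moreover have "X u (c *\<^sub>R x + y) = c *\<^sub>R X u x + X u y"
      by (simp add: X_eq algebra_simps)
    ultimately show ?case using step by (auto intro: span_add span_scale)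
  qed
qed (rule subspace_span)

lemma hom_eq_0:
  assumes "hom d A" "\<And>n f. f \<in> Gr n \<Longrightarrow> A f = 0"
  shows "A f = 0"
proof -
  have "A (P f) = 0"
    using P_in_span_Gr[of f]
  proof (induction rule: span_induct_alt)
    case base
    then show ?case using assms(1) by (auto simp: hom_def linear_0)
  next
    case (step c x y)
    then show ?case using assms by (auto simp: hom_def linear_add linear_cmul)
  qed
  then show ?thesis using assms(1) by (auto simp: hom_def)
qed

text \<open>Comparison of degrees: on \<open>Gr n\<close> the five values lie in five different
  graded spaces, hence vanish one by one, and the graded spaces span all representatives.\<close>

lemma hom_sum_eq_0:
  assumes h: "hom (-2) A" "hom (-1) B" "hom 0 C" "hom 1 D" "hom 2 E"
    and 0: "\<And>f. A f + B f + C f + D f + E f = 0"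
  shows "A f = 0" "B f = 0" "C f = 0" "D f = 0" "E f = 0"
proof -
  define V where "V f i = (if i = -2 then A f else if i = -1 then B f else if i = 0 then C f
    else if i = 1 then D f else E f)" for f and i :: int
  have *: "V f i = 0" if "f \<in> Gr n" "i \<in> {-2,-1,0,1,2}" for f n i
  proof (rule graded_independent[of "{-2,-1,0,1,2}" _ n])
    show "sum (V f) {- 2, - 1, 0, 1, 2} = 0"
      using 0[of f] by (simp add: V_def algebra_simps)
  qed (use h that in \<open>auto simp: V_def hom_def\<close>)
  show "A f = 0" by (rule hom_eq_0[OF h(1)]) (use *[of _ _ "-2"] in \<open>auto simp: V_def\<close>)
  show "B f = 0" by (rule hom_eq_0[OF h(2)]) (use *[of _ _ "-1"] in \<open>auto simp: V_def\<close>)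
  show "C f = 0" by (rule hom_eq_0[OF h(3)]) (use *[of _ _ 0] in \<open>auto simp: V_def\<close>)
  show "D f = 0" by (rule hom_eq_0[OF h(4)]) (use *[of _ _ 1] in \<open>auto simp: V_def\<close>)
  show "E f = 0" by (rule hom_eq_0[OF h(5)]) (use *[of _ _ 2] in \<open>auto simp: V_def\<close>)
qed

lemma am_vacuum [simp]: "am u \<Omega> = 0"
  using am_Gr[OF vacuum_Gr] by (simp add: Gr_neg)

lemma ap_vacuum_Gr: "ap u \<Omega> \<in> Gr 1"
  using ap_Gr[OF vacuum_Gr] by simp

text \<open>\<open>Gr 0\<close> is one-dimensional, so \<open>\<Omega>\<close> is an eigenvector;
  its eigenvalue is the mean of the linear form, which is 0 after centring.\<close>

lemma a0_vacuum [simp]: "a0 u \<Omega> = 0"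
proof -
  obtain k where k: "a0 u \<Omega> = k *\<^sub>R \<Omega>" using a0_Gr[OF vacuum_Gr] unfolding Gr_0 by auto
  have "ip (ap u \<Omega>) \<Omega> = 0" using Gr_orth[of 1 0] ap_vacuum_Gr vacuum_Gr by auto
  then have "k = 0" using centered[of u] by (simp add: X_eq k ip_vacuum)
  then show ?thesis using k by simp
qed

lemma X_vacuum: "X u \<Omega> = ap u \<Omega>" by (simp add: X_eq)

text \<open>In the symmetry of \<open>X u\<close> at most one of the three terms on each side
  survives orthogonality of degrees, and the survivors correspond to each other.\<close>

lemma adjoint_Gr:
  assumes f: "f \<in> Gr m" and g: "g \<in> Gr n"
  shows "ip (ap u f) g = ip f (am u g) \<and> ip (a0 u f) g = ip f (a0 u g)"
proof -
  have *: "ip (am u f) g + ip (a0 u f) g + ip (ap u f) g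
      = ip f (am u g) + ip f (a0 u g) + ip f (ap u g)"
    using X_sym[of u f g] by (simp add: X_eq)
  have z: "n \<noteq> m - 1 \<Longrightarrow> ip (am u f) g = 0" "n \<noteq> m \<Longrightarrow> ip (a0 u f) g = 0"
    "n \<noteq> m + 1 \<Longrightarrow> ip (ap u f) g = 0"  "m \<noteq> n - 1 \<Longrightarrow> ip f (am u g) = 0"
    "m \<noteq> n \<Longrightarrow> ip f (a0 u g) = 0" "m \<noteq> n + 1 \<Longrightarrow> ip f (ap u g) = 0"
    using am_Gr[OF f] a0_Gr[OF f] ap_Gr[OF f] am_Gr[OF g] a0_Gr[OF g] ap_Gr[OF g] Gr_orth f g
    by metis+
  consider "n = m + 1" | "n = m" | "n \<noteq> m" "n \<noteq> m + 1" by auto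
  then show ?thesis using * z by cases auto
qed

lemma adjoint: "ip (ap u f) g = ip f (am u g)" "ip (a0 u f) g = ip f (a0 u g)"
proof -
  have 1: "ip (ap u f) g = ip f (am u g) \<and> ip (a0 u f) g = ip f (a0 u g)" if g: "g \<in> Gr n" for f g n
  proof -
    have "ip (ap u (P f)) g = ip (P f) (am u g) \<and> ip (a0 u (P f)) g = ip (P f) (a0 u g)"
      using P_in_span_Gr[of f]
    proof (induction rule: span_induct_alt)
      case (step c x y)
      then obtain m where "x \<in> Gr m" by auto
      from adjoint_Gr[OF this g, of u] step show ?case by simp
    qed auto
    then show ?thesis by (simp add: op_P ip_P)
  qed
  have "ip (ap u f) (P g) = ip f (am u (P g)) \<and> ip (a0 u f) (P g) = ip f (a0 u (P g))"
    using P_in_span_Gr[of g]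
  proof (induction rule: span_induct_alt)
    case (step c x y)
    then obtain m where "x \<in> Gr m" by auto
    from 1[OF this, of f] step show ?case by simp
  qed auto
  then show "ip (ap u f) g = ip f (am u g)" "ip (a0 u f) g = ip f (a0 u g)"
    by (simp_all add: op_P ip_P ip_commute[of _ "P g"] ip_commute[of g])
qed

text \<open>These are the components of degree 2, 1 and 0 of the identity
  \<open>[X u, X v] = 0\<close>.\<close>

lemma ap_ap: "ap u (ap v f) = ap v (ap u f)"
    and a0_ap_swap: "comm (a0 u) (ap v) f = comm (a0 v) (ap u) f"
    and am_ap_swap: "comm (am u) (ap v) f - comm (am v) (ap u) f + comm (a0 u) (a0 v) f = 0"
proof -
  define A where "A = comm (am u) (am v)"
  define B where "B f = comm (am u) (a0 v) f + comm (a0 u) (am v) f" for f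
  define C where "C f = comm (am u) (ap v) f + comm (a0 u) (a0 v) f + comm (ap u) (am v) f" for f
  define D where "D f = comm (a0 u) (ap v) f + comm (ap u) (a0 v) f" for f
  define E where "E = comm (ap u) (ap v)"
  have h: "hom (-2) A" "hom (-1) B" "hom 0 C" "hom 1 D" "hom 2 E"
    unfolding A_def B_def C_def D_def E_def
    by (auto intro!: hom_intros hom_comm)
  have "A f + B f + C f + D f + E f = X u (X v f) - X v (X u f)" for f
    by (simp add: A_def B_def C_def D_def E_def comm_def X_eq algebra_simps)
  then have 0: "A f + B f + C f + D f + E f = 0" for f
    by (simp add: X_commute)
  note z = hom_sum_eq_0[OF h 0]
  show "ap u (ap v f) = ap v (ap u f)" using z(5)[of f] by (simp add: E_def comm_def)
  show "comm (a0 u) (ap v) f = comm (a0 v) (ap u) f"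
    using z(4)[of f] by (simp add: D_def comm_def algebra_simps)
  show "comm (am u) (ap v) f - comm (am v) (ap u) f + comm (a0 u) (a0 v) f = 0"
    using z(3)[of f] by (simp add: C_def comm_def algebra_simps)
qed

lemma closed_comm:
  assumes "A \<in> {am, a0, ap}" "B \<in> {am, a0, ap}"
  obtains w w' w'' c where "\<And>f. comm (A u) (B v) f = am w f + a0 w' f + ap w'' f + c *\<^sub>R P f"
  using closed[OF assms, of u v] unfolding comm_def by blast

text \<open>The commutator has degree 0, so the parts of other degree in \<open>closed\<close> drop
  out. The scalar is read off at the vacuum, where \<open>a0\<close> vanishes.\<close>

lemma comm_am_ap:
  obtains w where "\<And>f. comm (am u) (ap v) f = a0 w f + ip (ap u \<Omega>) (ap v \<Omega>) *\<^sub>R P f"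
proof -
  obtain w w' w'' c where
    *: "\<And>f. comm (am u) (ap v) f = am w f + a0 w' f + ap w'' f + c *\<^sub>R P f"
    by (rule closed_comm[of am ap u v], simp, simp) blast
  have h: "hom (-2) (\<lambda>_. 0)" "hom (-1) (am w)"
    "hom 0 (\<lambda>f. a0 w' f + c *\<^sub>R P f - comm (am u) (ap v) f)" "hom 1 (ap w'')" "hom 2 (\<lambda>_. 0)"
    by (auto intro!: hom_intros hom_comm)
  have "0 + am w f + (a0 w' f + c *\<^sub>R P f - comm (am u) (ap v) f) + ap w'' f + 0 = 0" for f
    using *[of f] by simp
  note z = hom_sum_eq_0[OF h this]
  have eq: "comm (am u) (ap v) f = a0 w' f + c *\<^sub>R P f" for f
    using z(3)[of f] by simp
  have "ip (ap u \<Omega>) (ap v \<Omega>) = ip (am u (ap v \<Omega>)) \<Omega>"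
    by (simp add: adjoint ip_commute)
  also have "am u (ap v \<Omega>) = c *\<^sub>R \<Omega>" using eq[of \<Omega>] by (simp add: comm_def)
  finally show thesis using that[of w'] eq by (simp add: ip_vacuum)
qed

lemma comm_a0_ap:
  obtains w where "\<And>f. comm (a0 u) (ap v) f = ap w f"
proof -
  obtain w w' w'' c where
    *: "\<And>f. comm (a0 u) (ap v) f = am w f + a0 w' f + ap w'' f + c *\<^sub>R P f"
    by (rule closed_comm[of a0 ap u v], simp, simp) blast
  have h: "hom (-2) (\<lambda>_. 0)" "hom (-1) (am w)" "hom 0 (\<lambda>f. a0 w' f + c *\<^sub>R P f)"
    "hom 1 (\<lambda>f. ap w'' f - comm (a0 u) (ap v) f)" "hom 2 (\<lambda>_. 0)"
    by (auto intro!: hom_intros hom_comm)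
  have "0 + am w f + (a0 w' f + c *\<^sub>R P f) + (ap w'' f - comm (a0 u) (ap v) f) + 0 = 0" for f
    using *[of f] by simp
  note z = hom_sum_eq_0[OF h this]
  show thesis using z(4) that[of w''] by simp
qed

text \<open>Here both sides vanish at the vacuum except for the scalar term, so the scalar is
  0.\<close>

lemma comm_a0_a0:
  obtains w where "\<And>f. comm (a0 u) (a0 v) f = a0 w f"
proof -
  obtain w w' w'' c where
    *: "\<And>f. comm (a0 u) (a0 v) f = am w f + a0 w' f + ap w'' f + c *\<^sub>R P f"
    by (rule closed_comm[of a0 a0 u v], simp, simp) blast
  have h: "hom (-2) (\<lambda>_. 0)" "hom (-1) (am w)"
    "hom 0 (\<lambda>f. a0 w' f + c *\<^sub>R P f - comm (a0 u) (a0 v) f)" "hom 1 (ap w'')" "hom 2 (\<lambda>_. 0)"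
    by (auto intro!: hom_intros hom_comm)
  have "0 + am w f + (a0 w' f + c *\<^sub>R P f - comm (a0 u) (a0 v) f) + ap w'' f + 0 = 0" for f
    using *[of f] by simp
  note z = hom_sum_eq_0[OF h this]
  have eq: "comm (a0 u) (a0 v) f = a0 w' f + c *\<^sub>R P f" for f
    using z(3)[of f] by simp
  have "c *\<^sub>R \<Omega> = 0" using eq[of \<Omega>] by (simp add: comm_def)
  then have "c = 0" using ip_vacuum by auto
  then show thesis using that[of w'] eq by simp
qed

section \<open>Words of creation operators applied to the vacuum\<close>

inductive_set words :: "'v set" where
  vacuum: "\<Omega> \<in> words"
| create: "w \<in> words \<Longrightarrow> ap u w \<in> words"

lemma P_word: "w \<in> words \<Longrightarrow> P w = w"
  by (induction rule: words.induct) (auto simp: P_op)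

lemma ap_span_words: "f \<in> span words \<Longrightarrow> ap u f \<in> span words"
  by (induction rule: span_induct_alt) (auto intro: span_zero span_add span_scale span_base create)

text \<open>The operator is moved to the right until it meets the vacuum; each commutator on the way
  replaces one creator by another.\<close>

lemma a0_word: "w \<in> words \<Longrightarrow> a0 u w \<in> span words"
proof (induction rule: words.induct)
  case (create w v)
  obtain z where z: "\<And>f. comm (a0 u) (ap v) f = ap z f" by (rule comm_a0_ap[of u v]) blast
  have "a0 u (ap v w) = ap v (a0 u w) + ap z w"
    using z[of w] by (simp add: comm_def algebra_simps)
  then show ?case using create by (auto intro!: span_add ap_span_words intro: span_base words.create)
qed (simp add: span_zero)

lemma am_word: "w \<in> words \<Longrightarrow> am u w \<in> span words"
proof (induction rule: words.induct)
  case (create w v)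
  obtain z where z: "\<And>f. comm (am u) (ap v) f = a0 z f + ip (ap u \<Omega>) (ap v \<Omega>) *\<^sub>R P f"
    by (rule comm_am_ap[of u v]) blast
  have "am u (ap v w) = ap v (am u w) + (a0 z w + ip (ap u \<Omega>) (ap v \<Omega>) *\<^sub>R w)"
    using z[of w] create by (simp add: comm_def P_word algebra_simps)
  then show ?case
    using create by (auto intro!: span_add ap_span_words a0_word span_scale intro: span_base)
qed (simp add: span_zero)

lemma P_in_span_words: "P f \<in> span words"
proof (rule cyclic)
  show "\<Omega> \<in> span words" by (auto intro: span_base vacuum)
  fix u f assume "f \<in> span words"
  then show "X u f \<in> span words"
  proof (induction rule: span_induct_alt)
    case base
    then show ?case by (simp add: X_eq span_zero)
  next
    case (step c x y)
    have "X u x \<in> span words"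
      unfolding X_eq using step(1) by (intro span_add am_word a0_word span_base create)
    moreover have "X u (c *\<^sub>R x + y) = c *\<^sub>R X u x + X u y"
      by (simp add: X_eq algebra_simps)
    ultimately show ?case using step by (auto intro: span_add span_scale)
  qed
qed (rule subspace_span)

text \<open>Since words span all representatives, such an operator is determined by its value at the
  vacuum. This is how information about a few vectors becomes an identity of operators.\<close>

lemma eq_0_of_commutes_with_creators:
  assumes D: "hom d D" "D \<Omega> = 0" and c: "\<And>u f. D (ap u f) = ap u (D f)"
  shows "D f = 0"
proof -
  have w: "D w = 0" if "w \<in> words" for w
    using that by (induction rule: words.induct) (auto simp: D c)
  have "D (P f) = 0"
    using P_in_span_words[of f]
  proof (induction rule: span_induct_alt)
    case base
    then show ?case using D(1) by (auto simp: hom_def linear_0)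
  next
    case (step c x y)
    then show ?case using D(1) w by (auto simp: hom_def linear_add linear_cmul)
  qed
  then show ?thesis using D(1) by (auto simp: hom_def)
qed

section \<open>The covariance and the cubic form on directions\<close>

definition cov :: "'u \<Rightarrow> 'u \<Rightarrow> real" where
  "cov u v = ip (ap u \<Omega>) (ap v \<Omega>)"

lemma cov_linear [simp]:
  "cov (u + u') v = cov u v + cov u' v" "cov (u - u') v = cov u v - cov u' v" "cov (r *\<^sub>R u) v = r * cov u v"
  "cov v (u + u') = cov v u + cov v u'" "cov v (u - u') = cov v u - cov v u'" "cov v (r *\<^sub>R u) = r * cov v u"
  by (simp_all add: cov_def index_linear)

lemma cov_commute: "cov u v = cov v u"
  unfolding cov_def by (rule ip_commute)

lemma cov_pos: "u \<noteq> 0 \<Longrightarrow> 0 < cov u u"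
  using nondegenerate[of u] ip_nonneg[of "ap u \<Omega>"] by (fastforce simp: X_vacuum cov_def)

text \<open>In the planar model this is the third mixed moment of the three centred linear forms:
  the components of \<open>X u (ap v \<Omega>)\<close> outside degree one are orthogonal to
  \<open>ap w \<Omega>\<close>.\<close>

definition cubic :: "'u \<Rightarrow> 'u \<Rightarrow> 'u \<Rightarrow> real" where
  "cubic u v w = ip (a0 u (ap v \<Omega>)) (ap w \<Omega>)"

lemma cubic_linear [simp]:
  "cubic (u + u') v w = cubic u v w + cubic u' v w" "cubic (u - u') v w = cubic u v w - cubic u' v w" "cubic (r *\<^sub>R u) v w = r * cubic u v w"
  "cubic u (v + v') w = cubic u v w + cubic u v' w" "cubic u (v - v') w = cubic u v w - cubic u v' w" "cubic u (r *\<^sub>R v) w = r * cubic u v w"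
  "cubic u v (w + w') = cubic u v w + cubic u v w'" "cubic u v (w - w') = cubic u v w - cubic u v w'" "cubic u v (r *\<^sub>R w) = r * cubic u v w"
  by (simp_all add: cubic_def index_linear)

lemma cubic_swap12: "cubic u v w = cubic v u w"
  using a0_ap_swap[of u v \<Omega>] by (simp add: cubic_def comm_def)

lemma cubic_swap23: "cubic u v w = cubic u w v"
  by (metis cubic_def adjoint(2) ip_commute)

text \<open>Evaluation at the vacuum identifies \<open>w\<close> as the vector that represents the
  linear form \<open>cubic u v\<close> with respect to \<open>cov\<close>. The commutators of
  \<open>a0\<close> with creators can thus be read off from the cubic form.\<close>

lemma a0_ap_eq_ap:
  obtains w where "a0 u (ap v \<Omega>) = ap w \<Omega>" "\<And>f. comm (a0 u) (ap v) f = ap w f"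
    "\<And>z. cubic u v z = cov w z"
proof -
  obtain w where w: "\<And>f. comm (a0 u) (ap v) f = ap w f" by (rule comm_a0_ap[of u v]) blast
  from w[of \<Omega>] have "a0 u (ap v \<Omega>) = ap w \<Omega>" by (simp add: comm_def)
  then show thesis using w by (intro that[of w]) (simp_all add: cubic_def cov_def)
qed

text \<open>The commutator of two preservation operators is again one, hence symmetric, but
  a commutator of symmetric operators is antisymmetric.\<close>

lemma a0_commute_Gr_1:
  "ip (a0 u (ap w \<Omega>)) (a0 v (ap z \<Omega>)) = ip (a0 v (ap w \<Omega>)) (a0 u (ap z \<Omega>))"
proof -
  obtain k where k: "\<And>f. comm (a0 u) (a0 v) f = a0 k f" by (rule comm_a0_a0[of u v]) blast
  have "ip (a0 k (ap w \<Omega>)) (ap z \<Omega>) = ip (ap w \<Omega>) (a0 k (ap z \<Omega>))" by (rule adjoint)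
  then show ?thesis unfolding k[symmetric] comm_def by (simp add: adjoint(2))
qed

definition orthonormal_basis :: "'u \<Rightarrow> 'u \<Rightarrow> bool" where
  "orthonormal_basis g h \<longleftrightarrow> cov g g = 1 \<and> cov h h = 1 \<and> cov g h = 0 \<and>
     (\<forall>u. u = cov u g *\<^sub>R g + cov u h *\<^sub>R h)"

text \<open>Gram-Schmidt with respect to \<open>cov\<close>; the two hypotheses say that
  \<open>b\<close>, \<open>b'\<close> form a basis.\<close>

lemma orthonormal_basis_exists:
  fixes b b' :: 'u
  assumes ind: "\<And>s t. s *\<^sub>R b + t *\<^sub>R b' = 0 \<Longrightarrow> s = 0 \<and> t = 0"
    and gen: "\<And>u. \<exists>s t. u = s *\<^sub>R b + t *\<^sub>R b'"
  obtains g h where "orthonormal_basis g h"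
proof -
  have "b \<noteq> 0"
  proof
    assume "b = 0"
    then have "1 *\<^sub>R b + 0 *\<^sub>R b' = 0" by simp
    from ind[OF this] show False by simp
  qed
  define r where "r = sqrt (cov b b)"
  have r: "r > 0" "r * r = cov b b" using cov_pos[OF \<open>b \<noteq> 0\<close>] by (auto simp: r_def)
  define k where "k = cov b' b / cov b b"
  define h' where "h' = b' + (- k) *\<^sub>R b"
  have "h' \<noteq> 0" using ind[of "- k" 1] by (auto simp: h'_def algebra_simps)
  define q where "q = sqrt (cov h' h')"
  have q: "q > 0" "q * q = cov h' h'" using cov_pos[OF \<open>h' \<noteq> 0\<close>] by (auto simp: q_def)
  define g where "g = (1 / r) *\<^sub>R b"
  define h where "h = (1 / q) *\<^sub>R h'"
  have "cov b b \<noteq> 0" using cov_pos[OF \<open>b \<noteq> 0\<close>] by simp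
  then have "cov b h' = 0" by (simp add: h'_def k_def cov_commute)
  then have gh: "cov g h = 0" by (simp add: g_def h_def)
  have "cov g g = cov b b / (r * r)" "cov h h = cov h' h' / (q * q)"
    by (simp_all add: g_def h_def)
  then have gg: "cov g g = 1" "cov h h = 1" 
    using r q cov_pos[OF \<open>b \<noteq> 0\<close>] cov_pos[OF \<open>h' \<noteq> 0\<close>] by simp_all
  have "u = cov u g *\<^sub>R g + cov u h *\<^sub>R h" for u
  proof -
    obtain s t where "u = s *\<^sub>R b + t *\<^sub>R b'" using gen by blast
    moreover have "b = r *\<^sub>R g" "b' = q *\<^sub>R h + (k * r) *\<^sub>R g"
      using r q by (auto simp: g_def h_def h'_def algebra_simps)
    ultimately have u: "u = (s * r + t * k * r) *\<^sub>R g + (t * q) *\<^sub>R h"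
      by (simp add: algebra_simps)
    show ?thesis by (simp add: u gg gh cov_commute[of h g])
  qed
  then show thesis using that gg gh unfolding orthonormal_basis_def by blast
qed

end

text \<open>For \<open>q = b\<close> and \<open>r = c - a\<close> the second equation says that
  \<open>(s, t)\<close> is an eigenvector of the symmetric matrix
  \<open>[[a, b], [b, c]]\<close>.\<close>

lemma unit_eigenvector:
  fixes q r :: real
  obtains s t where "s * s + t * t = 1" "q * (s * s - t * t) + r * (s * t) = 0"
proof (cases "q = 0")
  case True
  then show thesis using that[of 1 0] by simp
next
  case False
  \<comment> \<open>\<open>x\<close> plays the role of \<open>s / t\<close> and is a root of
    \<open>q * (x * x - 1) + r * x\<close>, whose discriminant is
    \<open>r\<^sup>2 + 4 * q\<^sup>2\<close>.\<close>
  define x where "x = (- r + sqrt (r\<^sup>2 + 4 * q\<^sup>2)) / (2 * q)"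
  have "2 * q * x + r = sqrt (r\<^sup>2 + 4 * q\<^sup>2)" using False by (simp add: x_def)
  then have "(2 * q * x + r)\<^sup>2 = r\<^sup>2 + 4 * q\<^sup>2" by simp
  then have "(4 * q) * (q * (x * x - 1) + r * x) = 0" by (simp add: power2_eq_square algebra_simps)
  then have x: "q * (x * x - 1) + r * x = 0" using False by simp
  define n where "n = sqrt (1 + x * x)"
  have n: "n > 0" "n * n = 1 + x * x" by (auto simp: n_def add_pos_nonneg)
  show thesis
  proof (rule that[of "x / n" "1 / n"])
    have "x / n * (x / n) + 1 / n * (1 / n) = (1 + x * x) / (n * n)"
      by (simp add: add_divide_distrib)
    then show "x / n * (x / n) + 1 / n * (1 / n) = 1" using n by auto
    have "q * (x / n * (x / n) - 1 / n * (1 / n)) + r * (x / n * (1 / n))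
        = (q * (x * x - 1) + r * x) / (n * n)"
      using n(1) by (simp add: field_simps)
    then show "q * (x / n * (x / n) - 1 / n * (1 / n)) + r * (x / n * (1 / n)) = 0"
      using x by simp
  qed
qed

text \<open>The matrices \<open>[[a, b], [b, c]]\<close> and \<open>[[b, c], [c, d]]\<close> of the cubic form commute by
  assumption; the rotation \<open>(s, t)\<close> is a unit eigenvector of one of them that is not diagonal.\<close>

lemma cubic_form_rotation:
  fixes a b c d :: real
  assumes "a * c + b * d = b * b + c * c"
  obtains s t where "s * s + t * t = 1"
    "- s * s * t * a + (s * s * s - 2 * s * t * t) * b + (2 * s * s * t - t * t * t) * c
       + s * t * t * d = 0"
    "s * t * t * a + (t * t * t - 2 * s * s * t) * b + (s * s * s - 2 * s * t * t) * c
       + s * s * t * d = 0"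
proof (cases "b = 0")
  case True
  then consider "c = 0" | "a = c" using assms by auto
  then show thesis
  proof cases
    case 1
    then show thesis using True that[of 1 0] by simp
  next
    case 2
    \<comment> \<open>With \<open>b = 0\<close> and \<open>a = c\<close> the first matrix is scalar,
      so the eigenvector is taken from the second one, \<open>[[0, c], [c, d]]\<close>.\<close>
    obtain s t where st: "s * s + t * t = 1" and 0: "c * (s * s - t * t) + d * (s * t) = 0"
      by (rule unit_eigenvector)
    have "t * (c * (s * s - t * t) + d * (s * t)) = 0" "s * (c * (s * s - t * t) + d * (s * t)) = 0"
      by (simp_all only: 0 mult_zero_right)
    then show thesis using True 2 by (intro that[OF st]) (simp_all add: algebra_simps)
  qed
next
  case False
  have d: "b * d = b * b + c * c - a * c" using assms by simp
  obtain s t where st: "s * s + t * t = 1" and 0: "b * (s * s - t * t) + (c - a) * (s * t) = 0"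
    by (rule unit_eigenvector)
  \<comment> \<open>Multiplication by \<open>b\<close> lets the commutation identity eliminate
    \<open>d\<close>; each expression then has the eigenvector equation as a factor.\<close>
  have "b * (- s * s * t * a + (s * s * s - 2 * s * t * t) * b + (2 * s * s * t - t * t * t) * c
      + s * t * t * d)
    = (s * b + t * c) * (b * (s * s - t * t) + (c - a) * (s * t))"
    using d by algebra
  moreover have "b * (s * t * t * a + (t * t * t - 2 * s * s * t) * b
      + (s * s * s - 2 * s * t * t) * c + s * s * t * d)
    = (s * c - t * b) * (b * (s * s - t * t) + (c - a) * (s * t))"
    using d by algebra
  ultimately show thesis
    using that[OF st] False unfolding 0 by (simp only: mult_zero_right mult_eq_0_iff) blast
qed

context fock
begin

lemma diagonal_basis_exists:
  assumes "orthonormal_basis g h"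
  obtains e e' where "orthonormal_basis e e'" "cubic e e e' = 0" "cubic e e' e' = 0"
proof -
  note gh = assms[unfolded orthonormal_basis_def]
  define a where "a = cubic g g g"
  define b where "b = cubic g g h"
  define c where "c = cubic g h h"
  define d where "d = cubic h h h"
  have c23: "cubic g h g = b" "cubic h g g = b" "cubic h g h = c" "cubic h h g = c"
    unfolding b_def c_def using cubic_swap12 cubic_swap23 by metis+
  have expand: "a0 u (ap v \<Omega>) = cubic u v g *\<^sub>R ap g \<Omega> + cubic u v h *\<^sub>R ap h \<Omega>" for u v
  proof -
    obtain w where w: "a0 u (ap v \<Omega>) = ap w \<Omega>" "\<And>z. cubic u v z = cov w z" by (rule a0_ap_eq_ap[of u v]) blast
    have "w = cov w g *\<^sub>R g + cov w h *\<^sub>R h" using gh by blast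
    then have "ap w \<Omega> = cov w g *\<^sub>R ap g \<Omega> + cov w h *\<^sub>R ap h \<Omega>"
      by (metis index_linear(7,9))
    then show ?thesis by (simp add: w)
  qed
  \<comment> \<open>On degree one \<open>a0 g\<close> and \<open>a0 h\<close> have the matrices
    \<open>[[a, b], [b, c]]\<close> and \<open>[[b, c], [c, d]]\<close>. A commutator of symmetric 2
    by 2 matrices has a single free entry, and this is its vanishing.\<close>
  have "a * c + b * d = b * b + c * c"
    using a0_commute_Gr_1[of h g g h] gh unfolding expand
    by (simp add: c23 a_def[symmetric] b_def[symmetric] c_def[symmetric] d_def[symmetric]
        cov_def[symmetric] cov_commute[of h g])
  then obtain s t where st: "s * s + t * t = 1"
    and 1: "- s * s * t * a + (s * s * s - 2 * s * t * t) * b + (2 * s * s * t - t * t * t) * c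
       + s * t * t * d = 0"
    and 2: "s * t * t * a + (t * t * t - 2 * s * s * t) * b + (s * s * s - 2 * s * t * t) * c
       + s * s * t * d = 0"
    by (rule cubic_form_rotation)
  define e where "e = s *\<^sub>R g + t *\<^sub>R h"
  define e' where "e' = (- t) *\<^sub>R g + s *\<^sub>R h"
  have g: "g = s *\<^sub>R e + (- t) *\<^sub>R e'" and h: "h = t *\<^sub>R e + s *\<^sub>R e'"
    using st by (simp_all add: e_def e'_def algebra_simps flip: scaleR_add_left)
  show thesis
  proof (rule that[of e e'])
    have "u = cov u e *\<^sub>R e + cov u e' *\<^sub>R e'" for u
    proof -
      have "u = cov u g *\<^sub>R g + cov u h *\<^sub>R h" using gh by blast
      also have "\<dots> = (s * cov u g + t * cov u h) *\<^sub>R e + (s * cov u h - t * cov u g) *\<^sub>R e'"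
        by (subst (2) g, subst (2) h) (simp add: algebra_simps)
      also have "s * cov u g + t * cov u h = cov u e" by (simp add: e_def)
      also have "s * cov u h - t * cov u g = cov u e'" by (simp add: e'_def)
      finally show ?thesis .
    qed
    then show "orthonormal_basis e e'"
      using gh st unfolding orthonormal_basis_def
      by (simp add: e_def e'_def cov_commute[of h g] algebra_simps)
    show "cubic e e e' = 0" "cubic e e' e' = 0"
      using 1 2 by (simp_all add: e_def e'_def c23 a_def[symmetric] b_def[symmetric]
          c_def[symmetric] d_def[symmetric] algebra_simps)
  qed
qed

end

section \<open>Decoupling the two directions of a diagonal basis\<close>

locale diagonal_fock = fock +
  fixes e1 e2 :: 'b
  assumes basis: "orthonormal_basis e1 e2"
    and cubic_mixed: "cubic e1 e1 e2 = 0" "cubic e1 e2 e2 = 0"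
begin

lemma diagonal_fock_swap: "diagonal_fock P ip \<Omega> Gr am a0 ap X e2 e1"
proof
  show "orthonormal_basis e2 e1"
    using basis unfolding orthonormal_basis_def by (metis add.commute cov_commute)
  show "cubic e2 e2 e1 = 0" "cubic e2 e1 e1 = 0"
    using cubic_mixed cubic_swap12 cubic_swap23 by metis+
qed

lemma cov_basis: "cov e1 e1 = 1" "cov e2 e2 = 1" "cov e1 e2 = 0" "cov e2 e1 = 0"
proof -
  have "cov e1 e1 = 1 \<and> cov e2 e2 = 1 \<and> cov e1 e2 = 0"
    using basis unfolding orthonormal_basis_def by blast
  then show "cov e1 e1 = 1" "cov e2 e2 = 1" "cov e1 e2 = 0" "cov e2 e1 = 0"
    using cov_commute[of e2 e1] by simp_all
qed

lemma expand: "u = cov u e1 *\<^sub>R e1 + cov u e2 *\<^sub>R e2"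
  using basis unfolding orthonormal_basis_def by blast

lemma cov_0: "cov 0 u = 0" "cov u 0 = 0"
  by (simp_all add: cov_def)

lemma cov_eqI:
  assumes "cov u e1 = cov v e1" "cov u e2 = cov v e2"
  shows "u = v"
  using expand[of u] expand[of v] assms by metis

text \<open>The third moment of the first coordinate; it will be the slope \<open>\<alpha>\<close>
  of the Szego-Jacobi parameters.\<close>

definition drift :: real where "drift = cubic e1 e1 e1"

lemma comm_a0_ap_same: "comm (a0 e1) (ap e1) f = drift *\<^sub>R ap e1 f"
proof -
  obtain w where w: "\<And>f. comm (a0 e1) (ap e1) f = ap w f" "\<And>z. cubic e1 e1 z = cov w z"
    by (rule a0_ap_eq_ap[of e1 e1]) blast
  have "w = drift *\<^sub>R e1"
    using w(2)[of e1] w(2)[of e2] cubic_mixed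
    by (intro cov_eqI) (simp_all add: drift_def cov_basis)
  then show ?thesis using w(1) by (simp add: index_linear)
qed

lemma comm_a0_ap_other: "comm (a0 e1) (ap e2) f = 0"
proof -
  obtain w where w: "\<And>f. comm (a0 e1) (ap e2) f = ap w f" "\<And>z. cubic e1 e2 z = cov w z"
    by (rule a0_ap_eq_ap[of e1 e2]) blast
  have "w = 0"
    using w(2)[of e1] w(2)[of e2] cubic_mixed cubic_swap23[of e1 e2 e1]
    by (intro cov_eqI) (simp_all add: cov_0)
  then show ?thesis using w(1) by simp
qed

lemma commutes_with_creators:
  assumes "\<And>f. D (ap e1 f) = ap e1 (D f)" "\<And>f. D (ap e2 f) = ap e2 (D f)" "linear D"
  shows "D (ap u f) = ap u (D f)"
  by (subst expand[of u], subst (2) expand[of u])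
    (simp add: index_linear assms linear_add linear_cmul)

text \<open>Without drift \<open>a0 e1\<close> commutes with all creators. A term with
  \<open>a0 e1\<close> is therefore 0 as soon as its coefficient times the drift is 0.\<close>

lemma a0_same_eq_0: "drift = 0 \<Longrightarrow> a0 e1 f = 0"
proof (rule eq_0_of_commutes_with_creators[of 0 "a0 e1"])
  fix u f assume "drift = 0"
  then have "a0 e1 (ap e1 f) = ap e1 (a0 e1 f)" "a0 e1 (ap e2 f) = ap e2 (a0 e1 f)" for f
    using comm_a0_ap_same[of f] comm_a0_ap_other[of f] by (simp_all add: comm_def)
  then show "a0 e1 (ap u f) = ap u (a0 e1 f)"
    by (rule commutes_with_creators[of "a0 e1", OF _ _ linear_op(2)])
qed (auto intro: hom_intros)

end

text \<open>The two directions play the same role: each fact about \<open>e1\<close> becomes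
  available for \<open>e2\<close> under the prefix \<open>swap\<close>.\<close>

sublocale diagonal_fock \<subseteq> swap: diagonal_fock P ip \<Omega> Gr am a0 ap X e2 e1
  by (rule diagonal_fock_swap)

context diagonal_fock
begin

lemma a0_ap:
  "a0 e1 (ap e1 f) = ap e1 (a0 e1 f) + drift *\<^sub>R ap e1 f"
  "a0 e2 (ap e2 f) = ap e2 (a0 e2 f) + swap.drift *\<^sub>R ap e2 f"
  "a0 e1 (ap e2 f) = ap e2 (a0 e1 f)" "a0 e2 (ap e1 f) = ap e1 (a0 e2 f)"
  using comm_a0_ap_same[of f] comm_a0_ap_other[of f]
    swap.comm_a0_ap_same[of f] swap.comm_a0_ap_other[of f]
  by (simp_all add: comm_def algebra_simps)

lemma comm_a0_a0_eq_0: "comm (a0 e1) (a0 e2) f = 0"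
proof (rule eq_0_of_commutes_with_creators[of 0 "comm (a0 e1) (a0 e2)"])
  fix u f
  show "comm (a0 e1) (a0 e2) (ap u f) = ap u (comm (a0 e1) (a0 e2) f)"
  proof (rule commutes_with_creators[of "comm (a0 e1) (a0 e2)"])
    show "linear (comm (a0 e1) (a0 e2))"
      using hom_comm[OF hom_intros(2,2), of 0 e1 e2] by (simp add: hom_def)
  qed (simp_all add: comm_def a0_ap)
qed (rule hom_comm[OF hom_intros(2,2)], simp, simp add: comm_def)

text \<open>Evaluating \<open>[a\<^sup>-, a\<^sup>+]\<close> on a creator in two ways (the Jacobi identity) forces the
  coefficients that would couple the two directions to vanish.\<close>

lemma am_ap_commutators:
  obtains p where "\<And>f. comm (am e1) (ap e1) f = P f + p *\<^sub>R a0 e1 f"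
    and "\<And>f. comm (am e1) (ap e2) f = 0"
proof -
  have split: "a0 w f = cov w e1 *\<^sub>R a0 e1 f + cov w e2 *\<^sub>R a0 e2 f" for w f
    by (subst expand[of w]) (simp only: index_linear)
  obtain w1 where w1: "\<And>f. comm (am e1) (ap e1) f = a0 w1 f + P f"
    by (rule comm_am_ap[of e1 e1]) (use cov_basis in \<open>auto simp: cov_def\<close>)
  obtain w2 where w2: "\<And>f. comm (am e2) (ap e2) f = a0 w2 f + P f"
    by (rule comm_am_ap[of e2 e2]) (use cov_basis in \<open>auto simp: cov_def\<close>)
  obtain w where w: "\<And>f. comm (am e1) (ap e2) f = a0 w f"
    by (rule comm_am_ap[of e1 e2]) (use cov_basis in \<open>auto simp: cov_def\<close>)
  \<comment> \<open>As the preservation operators commute, \<open>am_ap_swap\<close> gives both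
    mixed commutators the same \<open>w\<close>.\<close>
  have w': "comm (am e2) (ap e1) f = a0 w f" for f
    using am_ap_swap[of e1 e2 f] comm_a0_a0_eq_0[of f] w[of f] by simp
  define p where "p = cov w e1"
  define q where "q = cov w e2"
  define p1 where "p1 = cov w1 e1"
  define q1 where "q1 = cov w1 e2"
  define p2 where "p2 = cov w2 e1"
  define q2 where "q2 = cov w2 e2"
  have am_ap:
    "am e1 (ap e1 f) = ap e1 (am e1 f) + P f + p1 *\<^sub>R a0 e1 f + q1 *\<^sub>R a0 e2 f"
    "am e2 (ap e2 f) = ap e2 (am e2 f) + P f + p2 *\<^sub>R a0 e1 f + q2 *\<^sub>R a0 e2 f"
    "am e1 (ap e2 f) = ap e2 (am e1 f) + p *\<^sub>R a0 e1 f + q *\<^sub>R a0 e2 f"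
    "am e2 (ap e1 f) = ap e1 (am e2 f) + p *\<^sub>R a0 e1 f + q *\<^sub>R a0 e2 f" for f
    using w1[of f] w2[of f] w[of f] w'[of f]
    by (simp_all add: comm_def split[of w1] split[of w2] split[of w] p_def q_def p1_def q1_def
        p2_def q2_def algebra_simps)
  \<comment> \<open>The creators commute, so an annihilator can pass them in either order. The
    outcomes differ by a combination of \<open>ap e1 \<Omega>\<close> and
    \<open>ap e2 \<Omega>\<close>; as these are orthonormal, its coefficients vanish.\<close>
  have "am e2 (ap e1 (ap e2 \<Omega>)) = am e2 (ap e2 (ap e1 \<Omega>))" by (simp add: ap_ap[of e1 e2])
  then have 1: "(q * swap.drift) *\<^sub>R ap e2 \<Omega> = (p2 * drift) *\<^sub>R ap e1 \<Omega>"
    by (simp add: am_ap a0_ap P_op)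
  have "am e1 (ap e2 (ap e1 \<Omega>)) = am e1 (ap e1 (ap e2 \<Omega>))" by (simp add: ap_ap[of e1 e2])
  then have 2: "(p * drift) *\<^sub>R ap e1 \<Omega> = (q1 * swap.drift) *\<^sub>R ap e2 \<Omega>"
    by (simp add: am_ap a0_ap P_op)
  have "q * swap.drift = 0"
    using arg_cong[OF 1, of "\<lambda>v. ip v (ap e2 \<Omega>)"] cov_basis by (simp add: cov_def)
  moreover have "p * drift = 0" "q1 * swap.drift = 0"
    using arg_cong[OF 2, of "\<lambda>v. ip v (ap e1 \<Omega>)"] arg_cong[OF 2, of "\<lambda>v. ip v (ap e2 \<Omega>)"] cov_basis
    by (simp_all add: cov_def)
  \<comment> \<open>Either the coefficient vanishes, or the drift does and with it the preservation
    operator.\<close>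
  ultimately have 0: "p *\<^sub>R a0 e1 f = 0" "q *\<^sub>R a0 e2 f = 0" "q1 *\<^sub>R a0 e2 f = 0" for f
    using a0_same_eq_0[of f] swap.a0_same_eq_0[of f] by auto
  show thesis
    by (rule that[of p1]) (simp_all add: comm_def am_ap 0)
qed

end

section \<open>The ladder in one direction and its three-term recurrence\<close>

context diagonal_fock
begin

definition chain :: "nat \<Rightarrow> 'a" where
  "chain n = (ap e1 ^^ n) \<Omega>"

lemma chain_simps: "chain 0 = \<Omega>" "chain (Suc n) = ap e1 (chain n)"
  by (simp_all add: chain_def)

lemma chain_Gr: "chain n \<in> Gr (int n)"
proof (induction n)
  case (Suc n)
  from ap_Gr[OF this, of e1] show ?case by (simp add: chain_simps add.commute)
qed (simp add: chain_simps vacuum_Gr)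

lemma chain_orthogonal: "m \<noteq> n \<Longrightarrow> ip (chain m) (chain n) = 0"
  using Gr_orth chain_Gr by (metis of_nat_eq_iff)

text \<open>Moving \<open>am e1\<close> past \<open>n\<close> creators to the vacuum collects the
  sum of \<open>1 + p * drift * k\<close> over \<open>k < n\<close>, which is
  \<open>n * (1 + \<beta> * (n - 1))\<close> for \<open>\<beta> = p * drift / 2\<close>. At
  \<open>n = 0\<close> this factor is 0, so the truncated index \<open>n - 1\<close> is harmless
  there.\<close>

lemma X_chain:
  obtains \<beta> where "drift = 0 \<Longrightarrow> \<beta> = 0"
    and "\<And>n. X e1 (chain n) = chain (Suc n) + (drift * real n) *\<^sub>R chain n
      + (real n * (1 + \<beta> * (real n - 1))) *\<^sub>R chain (n - 1)"
proof -
  obtain p where p: "\<And>f. comm (am e1) (ap e1) f = P f + p *\<^sub>R a0 e1 f"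
    by (rule am_ap_commutators) blast
  define \<beta> where "\<beta> = p * drift / 2"
  have a0: "a0 e1 (chain n) = (drift * real n) *\<^sub>R chain n" for n
  proof (induction n)
    case (Suc n)
    show ?case by (simp add: chain_simps a0_ap Suc algebra_simps)
  qed (simp add: chain_simps)
  have am: "am e1 (chain n) = (real n * (1 + \<beta> * (real n - 1))) *\<^sub>R chain (n - 1)" for n
  proof (induction n)
    case (Suc n)
    have P: "P (chain n) = chain n" using P_Gr chain_Gr by blast
    have "am e1 (chain (Suc n)) = ap e1 (am e1 (chain n)) + chain n + p *\<^sub>R a0 e1 (chain n)"
      using p[of "chain n"] by (simp add: comm_def chain_simps P algebra_simps)
    also have "\<dots> = (real n * (1 + \<beta> * (real n - 1))) *\<^sub>R ap e1 (chain (n - 1)) + chain n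
        + (p * drift * real n) *\<^sub>R chain n"
      by (simp add: Suc a0)
    also have "(real n * (1 + \<beta> * (real n - 1))) *\<^sub>R ap e1 (chain (n - 1))
        = (real n * (1 + \<beta> * (real n - 1))) *\<^sub>R chain n"
      by (cases n) (simp_all add: chain_simps)
    also have "\<dots> + chain n + (p * drift * real n) *\<^sub>R chain n
        = (real (Suc n) * (1 + \<beta> * (real (Suc n) - 1))) *\<^sub>R chain n"
    proof -
      have "real n * (1 + \<beta> * (real n - 1)) + 1 + p * drift * real n
          = real (Suc n) * (1 + \<beta> * (real (Suc n) - 1))"
        by (simp add: \<beta>_def field_simps)
      then show ?thesis by (metis scaleR_add_left scaleR_one)
    qed
    finally show ?case by simp
  qed (simp add: chain_simps)
  show thesis
    by (rule that[of \<beta>]) (simp add: \<beta>_def, simp add: X_eq a0 am chain_simps)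
qed

end

section \<open>Factorisation of the mixed moments\<close>

context diagonal_fock
begin

text \<open>Powers of \<open>X e2\<close> applied to the vacuum lie in the span of the second
  ladder. As \<open>X e1\<close> commutes with \<open>ap e2\<close>, every rung above the vacuum can
  be paired with \<open>\<Omega>\<close> with \<open>ap e2\<close> outermost, and gives 0; only the
  vacuum component contributes.\<close>

lemma X_factor:
  "ip ((X e1 ^^ m) \<Omega>) ((X e2 ^^ n) \<Omega>) = ip ((X e1 ^^ m) \<Omega>) \<Omega> * ip ((X e2 ^^ n) \<Omega>) \<Omega>"
proof -
  obtain \<beta> where X2: "\<And>n. X e2 (swap.chain n) = swap.chain (Suc n)
      + (swap.drift * real n) *\<^sub>R swap.chain n
      + (real n * (1 + \<beta> * (real n - 1))) *\<^sub>R swap.chain (n - 1)"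
    by (rule swap.X_chain) blast
  have span: "(X e2 ^^ n) \<Omega> \<in> span (range swap.chain)"
  proof (induction n)
    case 0
    show ?case using span_base[OF rangeI[of swap.chain 0]] by (simp add: swap.chain_simps)
  next
    case (Suc n)
    have "X e2 v \<in> span (range swap.chain)" if "v \<in> span (range swap.chain)" for v
      using that
    proof (induction rule: span_induct_alt)
      case base
      then show ?case by (simp add: X_eq span_zero)
    next
      case (step c x y)
      then obtain k where "x = swap.chain k" by auto
      then have "X e2 x \<in> span (range swap.chain)"
        by (simp only: X2) (intro span_add span_scale span_base rangeI)
      moreover have "X e2 (c *\<^sub>R x + y) = c *\<^sub>R X e2 x + X e2 y"
        by (simp add: X_eq algebra_simps)
      ultimately show ?case using step by (auto intro: span_add span_scale)
    qed
    then show ?case using Suc by simp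
  qed
  obtain p where "\<And>f. comm (am e1) (ap e2) f = 0"
    by (rule am_ap_commutators) blast
  then have X_ap: "X e1 (ap e2 f) = ap e2 (X e1 f)" for f
    by (simp add: X_eq a0_ap ap_ap[of e1 e2] comm_def)
  have Xpow: "(X e1 ^^ m) (ap e2 f) = ap e2 ((X e1 ^^ m) f)" for f
    by (induction m) (simp_all add: X_ap)
  have Xsym: "ip ((X e1 ^^ m) f) g = ip f ((X e1 ^^ m) g)" for f g
    by (induction m arbitrary: g) (simp_all add: X_sym flip: funpow_swap1)
  have "ip ((X e1 ^^ m) \<Omega>) v = ip ((X e1 ^^ m) \<Omega>) \<Omega> * ip v \<Omega>" if "v \<in> span (range swap.chain)" for v
    using that
  proof (induction rule: span_induct_alt)
    case (step c x y)
    then obtain k where k: "x = swap.chain k" by auto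
    have "ip ((X e1 ^^ m) \<Omega>) x = ip ((X e1 ^^ m) \<Omega>) \<Omega> * ip x \<Omega>"
    proof (cases k)
      case 0
      then show ?thesis by (simp add: k swap.chain_simps ip_vacuum)
    next
      case (Suc j)
      then have "ip ((X e1 ^^ m) \<Omega>) x = ip \<Omega> (ap e2 ((X e1 ^^ m) (swap.chain j)))"
        by (simp add: k swap.chain_simps Xsym Xpow)
      also have "\<dots> = 0" by (simp add: ip_commute[of \<Omega>] adjoint(1))
      finally show ?thesis
        using swap.chain_orthogonal[of k 0] Suc by (simp add: k swap.chain_simps)
    qed
    then show ?case using step by (simp add: algebra_simps)
  qed simp
  from this[OF span] show ?thesis .
qed

end

section \<open>The operators of a planar measure\<close>

locale meixner_plane = plane_measure \<mu> for \<mu> +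
  fixes axm ax0 axp aym ay0 ayp :: operator
  assumes decomposition_x: "quantum_decomposition \<mu> mult_x axm ax0 axp"
    and decomposition_y: "quantum_decomposition \<mu> mult_y aym ay0 ayp"
    and closed: "A \<in> op_span [axm, ax0, axp, aym, ay0, ayp, \<lambda>f. f] \<Longrightarrow>
      B \<in> op_span [axm, ax0, axp, aym, ay0, ayp, \<lambda>f. f] \<Longrightarrow>
      \<exists>C \<in> op_span [axm, ax0, axp, aym, ay0, ayp, \<lambda>f. f]. op_eq \<mu> (commutator A B) C"
    and no_line: "a\<^sup>2 + b\<^sup>2 > 0 \<Longrightarrow> \<not> supported_by \<mu> (line a b c)"
begin

lemma is_operators: "is_operator \<mu> axm" "is_operator \<mu> ax0" "is_operator \<mu> axp"
  "is_operator \<mu> aym" "is_operator \<mu> ay0" "is_operator \<mu> ayp" "is_operator \<mu> (\<lambda>f. f)"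
  using decomposition_x decomposition_y
  by (auto simp: quantum_decomposition_def is_operator_def ae_eq_def
      intro: polys_add[unfolded plus_fun_def] polys_scale[unfolded scaleR_fun_def real_scaleR_def])

definition combination :: "(nat \<Rightarrow> real) \<Rightarrow> operator" where
  "combination c = (\<lambda>f z. c 0 * axm f z + c 1 * ax0 f z + c 2 * axp f z
     + c 3 * aym f z + c 4 * ay0 f z + c 5 * ayp f z + c 6 * f z)"

lemma op_span_eq: "op_span [axm, ax0, axp, aym, ay0, ayp, \<lambda>f. f] = range combination"
  unfolding op_span_def combination_def
  by (auto simp: eval_nat_numeral)

lemma operator_polys: "is_operator \<mu> A \<Longrightarrow> f \<in> polys \<Longrightarrow> A f \<in> polys"
  by (simp add: is_operator_def)

lemma combination_eq: "combination c f = c 0 *\<^sub>R axm f + c 1 *\<^sub>R ax0 f + c 2 *\<^sub>R axp f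
     + c 3 *\<^sub>R aym f + c 4 *\<^sub>R ay0 f + c 5 *\<^sub>R ayp f + c 6 *\<^sub>R f"
  by (simp add: combination_def fun_eq_iff)

lemma combination_polys: "f \<in> polys \<Longrightarrow> combination c f \<in> polys"
  unfolding combination_eq by (intro polys_add polys_scale is_operators(1-6)[THEN operator_polys])

lemma combination_AE:
  assumes "f \<in> polys" "g \<in> polys" "AE z in \<mu>. f z = g z"
  shows "AE z in \<mu>. combination c f z = combination c g z"
proof -
  have "AE z in \<mu>. A f z = A g z" if "is_operator \<mu> A" for A
    using that assms by (simp add: is_operator_def ae_eq_def)
  note * = is_operators[THEN this]
  show ?thesis
    using *(1) *(2) *(3) *(4) *(5) *(6) assms(3)
    by eventually_elim (simp add: combination_def)
qed

definition mean_x :: real where "mean_x = expectation fst"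
definition mean_y :: real where "mean_y = expectation snd"

definition mean :: "real \<times> real \<Rightarrow> real" where
  "mean u = fst u * mean_x + snd u * mean_y"

definition form :: "real \<times> real \<Rightarrow> real \<times> real \<Rightarrow> real" where
  "form u = (\<lambda>z. fst u * (fst z - mean_x) + snd u * (snd z - mean_y))"

definition X :: "real \<times> real \<Rightarrow> operator" where
  "X u f = P (form u * P f)"

definition am :: "real \<times> real \<Rightarrow> operator" where
  "am u f = fst u *\<^sub>R P (axm (P f)) + snd u *\<^sub>R P (aym (P f))"

text \<open>Centring subtracts a scalar, which has degree 0, so only the preservation part
  changes.\<close>

definition a0 :: "real \<times> real \<Rightarrow> operator" where
  "a0 u f = fst u *\<^sub>R P (ax0 (P f)) + snd u *\<^sub>R P (ay0 (P f)) - mean u *\<^sub>R P f"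

definition ap :: "real \<times> real \<Rightarrow> operator" where
  "ap u f = fst u *\<^sub>R P (axp (P f)) + snd u *\<^sub>R P (ayp (P f))"

lemma form_eq: "form u = fst u *\<^sub>R fst + snd u *\<^sub>R snd - mean u *\<^sub>R 1"
  by (simp add: form_def mean_def fun_eq_iff algebra_simps)

lemma form_polys: "form u \<in> polys"
  unfolding form_eq by (intro polys_add polys_diff polys_scale fst_polys snd_polys polys_1)

text \<open>Expressing \<open>ax0\<close> and \<open>ay0\<close> by the centred \<open>a0\<close>
  moves their means into the coefficient of the identity; the identity in the span absorbs
  them.\<close>

lemma P_combination:
  "P (combination c (P f)) = am (c 0, c 3) f + a0 (c 1, c 4) f + ap (c 2, c 5) f
     + (c 6 + mean (c 1, c 4)) *\<^sub>R P f"
  by (simp add: combination_eq P_add P_scale P_idem am_def a0_def ap_def algebra_simps)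

lemma represented:
  assumes "A \<in> {am, a0, ap}"
  obtains c where "\<And>f. A u f = P (combination c (P f))"
proof -
  consider "A = am" | "A = a0" | "A = ap" using assms by auto
  then show thesis
  proof cases
    case 1
    show thesis
      by (rule that[of "(\<lambda>_. 0)(0 := fst u, 3 := snd u)"])
        (simp add: 1 P_combination a0_def ap_def mean_def zero_prod_def[symmetric])
  next
    case 2
    show thesis
      by (rule that[of "(\<lambda>_. 0)(1 := fst u, 4 := snd u, 6 := - mean u)"])
        (simp add: 2 P_combination am_def ap_def mean_def zero_prod_def[symmetric])
  next
    case 3
    show thesis
      by (rule that[of "(\<lambda>_. 0)(2 := fst u, 5 := snd u)"])
        (simp add: 3 P_combination a0_def am_def mean_def zero_prod_def[symmetric])
  qed
qed

lemma closed_lifted: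
  assumes "A \<in> {am, a0, ap}" "B \<in> {am, a0, ap}"
  shows "\<exists>w w' w'' c. \<forall>f. A u (B v f) - B v (A u f) = am w f + a0 w' f + ap w'' f + c *\<^sub>R P f"
proof -
  obtain a where a: "\<And>f. A u f = P (combination a (P f))" using represented[OF assms(1)] by blast
  obtain b where b: "\<And>f. B v f = P (combination b (P f))" using represented[OF assms(2)] by blast
  obtain c where c: "op_eq \<mu> (commutator (combination a) (combination b)) (combination c)"
    using closed[of "combination a" "combination b"] unfolding op_span_eq by auto
  have lift: "P (combination a (P (P (combination b (P f))))) = P (combination a (combination b (P f)))"
    for a b f
    unfolding P_idem by (intro P_eqI combination_polys combination_AE P_AE P_polys)
  have "A u (B v f) - B v (A u f) = P (combination c (P f))" for f
  proof -
    have "A u (B v f) - B v (A u f)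
      = P (combination a (combination b (P f)) - combination b (combination a (P f)))"
      by (simp only: a b lift P_diff)
    also have "\<dots> = P (combination c (P f))"
      using c by (intro P_eqI combination_polys polys_diff P_polys)
        (auto simp: op_eq_def ae_eq_def commutator_def P_polys)
    finally show ?thesis .
  qed
  then show ?thesis unfolding P_combination by blast
qed

lemma form_mult_polys: "f \<in> polys \<Longrightarrow> form u * f \<in> polys"
  by (intro polys_mult form_polys)

lemma X_polys:
  assumes "f \<in> polys"
  shows "X u (P f) = P (form u * f)"
proof -
  have "AE z in \<mu>. (form u * P f) z = (form u * f) z" using P_AE[OF assms] by eventually_elim simp
  then show ?thesis unfolding X_def P_idem by (intro P_eqI form_mult_polys P_polys assms)
qed

lemma X_decomposition: "X u f = am u f + a0 u f + ap u f"
proof -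
  note ops = is_operators[THEN operator_polys, OF P_polys]
  have "AE z in \<mu>. mult_x (P f) z = axm (P f) z + ax0 (P f) z + axp (P f) z"
    using decomposition_x P_polys by (simp add: quantum_decomposition_def op_eq_def ae_eq_def)
  then have "AE z in \<mu>. (fst * P f) z = (axm (P f) + ax0 (P f) + axp (P f)) z"
    by eventually_elim (simp add: mult_x_def)
  then have x: "P (fst * P f) = P (axm (P f)) + P (ax0 (P f)) + P (axp (P f))"
    unfolding P_add[symmetric]
    by (intro P_eqI polys_add polys_mult fst_polys ops P_polys)
  have "AE z in \<mu>. mult_y (P f) z = aym (P f) z + ay0 (P f) z + ayp (P f) z"
    using decomposition_y P_polys by (simp add: quantum_decomposition_def op_eq_def ae_eq_def)
  then have "AE z in \<mu>. (snd * P f) z = (aym (P f) + ay0 (P f) + ayp (P f)) z"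
    by eventually_elim (simp add: mult_y_def)
  then have y: "P (snd * P f) = P (aym (P f)) + P (ay0 (P f)) + P (ayp (P f))"
    unfolding P_add[symmetric]
    by (intro P_eqI polys_add polys_mult snd_polys ops P_polys)
  have "form u * P f = fst u *\<^sub>R (fst * P f) + snd u *\<^sub>R (snd * P f) - mean u *\<^sub>R P f"
    by (simp add: form_eq fun_eq_iff algebra_simps)
  then have "X u f = fst u *\<^sub>R P (fst * P f) + snd u *\<^sub>R P (snd * P f) - mean u *\<^sub>R P f"
    unfolding X_def by (simp only: P_add P_diff P_scale P_idem)
  then show ?thesis
    unfolding x y by (simp add: am_def a0_def ap_def algebra_simps)
qed

lemma expectation_form: "expectation (form u) = 0"
proof -
  have "integrable \<mu> fst" "integrable \<mu> snd"
    using integrable_polys fst_polys snd_polys by blast+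
  then show ?thesis
    unfolding form_def by (simp add: prob_space mean_x_def mean_y_def)
qed

text \<open>Multiplication by a coordinate is \<open>X\<close> of a unit vector plus a scalar, and
  the monomials arise from 1 by such multiplications.\<close>

lemma cyclic:
  assumes S: "subspace S" "P 1 \<in> S" "\<And>u f. f \<in> S \<Longrightarrow> X u f \<in> S"
  shows "P f \<in> S"
proof -
  have shift: "P (h * f) \<in> S" if f: "f \<in> polys" "P f \<in> S" and h: "h = form u + mean u *\<^sub>R 1" for f h u
  proof -
    have "h * f = form u * f + mean u *\<^sub>R f" by (simp add: h fun_eq_iff algebra_simps)
    then have "P (h * f) = X u (P f) + mean u *\<^sub>R P f" by (simp only: X_polys[OF f(1)] P_add P_scale)
    then show ?thesis using f S by (simp add: subspace_add subspace_scale)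
  qed
  have x: "fst = form (1, 0) + mean (1, 0) *\<^sub>R 1" and y: "snd = form (0, 1) + mean (0, 1) *\<^sub>R 1"
    by (auto simp: form_def mean_def fun_eq_iff)
  have mono: "P (monomial i j) \<in> S" for i j
  proof (induction i)
    case 0
    show ?case
    proof (induction j)
      case 0
      then show ?case using S(2) by (simp add: one_eq_monomial)
    next
      case (Suc j)
      have "snd * monomial 0 j = monomial 0 (Suc j)" by (auto simp: monomial_def fun_eq_iff)
      then show ?case using shift[OF monomial_polys Suc y] by simp
    qed
  next
    case (Suc i)
    have "fst * monomial i j = monomial (Suc i) j" by (auto simp: monomial_def fun_eq_iff)
    then show ?case using shift[OF monomial_polys Suc x] by simp
  qed
  have "P g \<in> S" if "g \<in> polys" for g
    using that unfolding polys_span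
  proof (induction rule: span_induct_alt)
    case base
    show ?case unfolding P_0 using S(1) by (rule subspace_0)
  next
    case (step c x y)
    then show ?case using S(1) mono
      by (auto simp only: P_add P_scale intro!: subspace_add subspace_scale)
  qed
  from this[OF P_polys, of f] show ?thesis by (simp only: P_idem)
qed

text \<open>A linear form of variance 0 is constant almost everywhere, so for \<open>u\<close>
  nonzero the measure would live on a line with coefficient vector \<open>u\<close>.\<close>

lemma nondegenerate: "ip (X u (P 1)) (X u (P 1)) = 0 \<Longrightarrow> u = 0"
proof -
  assume "ip (X u (P 1)) (X u (P 1)) = 0"
  then have "P (X u (P 1)) = 0" by (rule ip_eq_0)
  then have "P (form u * 1) = 0" unfolding X_polys[OF polys_1] P_idem .
  then have "AE z in \<mu>. form u z = 0"
    using P_AE[OF form_mult_polys[OF polys_1, of u]] by simp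
  then have "AE z in \<mu>. z \<in> line (fst u) (snd u) (mean u)"
    by eventually_elim (auto simp: form_eq line_def)
  then have "\<not> (fst u)\<^sup>2 + (snd u)\<^sup>2 > 0" using no_line unfolding supported_by_def by blast
  then have "fst u = 0" "snd u = 0" by (auto simp: sum_power2_gt_zero_iff)
  then show "u = 0" by (simp add: prod_eq_iff)
qed

lemma fock: "fock P ip (P 1) Gr am a0 ap X"
proof (rule fock.intro)
  note lin = linear_lift[OF is_operators(1)] linear_lift[OF is_operators(2)]
    linear_lift[OF is_operators(3)] linear_lift[OF is_operators(4)]
    linear_lift[OF is_operators(5)] linear_lift[OF is_operators(6)]
  show "linear P" by (rule linear_P)
  show "P (P f) = P f" for f by (rule P_idem)
  show "bilinear ip" by (rule bilinear_ip)
  show "ip f g = ip g f" for f g by (rule ip_commute)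
  show "ip (P f) g = ip f g" for f g by (simp add: ip_def P_idem)
  show "0 \<le> ip f f" for f by (rule ip_nonneg)
  show "P f = 0" if "ip f f = 0" for f using that by (rule ip_eq_0)
  show "subspace (Gr n)" for n by (rule subspace_Gr)
  show "P f = f" if "f \<in> Gr n" for f n using that P_idem by (auto simp: Gr_def)
  show "Gr n = {0}" if "n < 0" for n using that by (rule Gr_neg)
  show "Gr 0 = range (\<lambda>r. r *\<^sub>R P 1)" by (rule Gr_0)
  show "ip (P 1) (P 1) = 1"
  proof -
    have "ip (P 1) (P 1) = ip 1 1" by (simp add: ip_def P_idem)
    then show ?thesis using ip_polys[OF polys_1 polys_1] prob_space by simp
  qed
  show "ip f g = 0" if "m \<noteq> n" "f \<in> Gr m" "g \<in> Gr n" for m n f g using that by (rule Gr_orth)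
  show "linear (\<lambda>u. am u f)" "linear (\<lambda>u. a0 u f)" "linear (\<lambda>u. ap u f)" for f
    by (auto simp: linear_iff am_def a0_def ap_def mean_def algebra_simps)
  show "linear (am u)" "linear (ap u)" for u
    unfolding am_def ap_def by (intro linear_compose_add linear_compose_scale_right lin)+
  show "linear (a0 u)" for u
    unfolding a0_def by (intro linear_compose_add linear_compose_sub linear_compose_scale_right lin linear_P)
  show "am u (P f) = am u f" "a0 u (P f) = a0 u f" "ap u (P f) = ap u f" for u f
    by (simp_all add: am_def a0_def ap_def P_idem)
  show "P (am u f) = am u f" "P (a0 u f) = a0 u f" "P (ap u f) = ap u f" for u f
    by (simp_all add: am_def a0_def ap_def P_idem P_add P_diff P_scale)
  show "am u f \<in> Gr (n - 1)" if f: "f \<in> Gr n" for u f n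
  proof -
    have "P (axm (P f)) \<in> Gr (n + - 1)" "P (aym (P f)) \<in> Gr (n + - 1)"
      using decomposition_x decomposition_y
      by (intro lift_Gr is_operators f; simp add: quantum_decomposition_def)+
    then show ?thesis unfolding am_def using subspace_Gr[of "n - 1"]
      by (simp add: subspace_add subspace_scale)
  qed
  show "a0 u f \<in> Gr n" if f: "f \<in> Gr n" for u f n
  proof -
    have "P (ax0 (P f)) \<in> Gr (n + 0)" "P (ay0 (P f)) \<in> Gr (n + 0)"
      using decomposition_x decomposition_y
      by (intro lift_Gr is_operators f; simp add: quantum_decomposition_def)+
    moreover have "P f \<in> Gr n" using f P_idem by (auto simp: Gr_def)
    ultimately show ?thesis unfolding a0_def using subspace_Gr[of n]
      by (simp add: subspace_add subspace_diff subspace_scale)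
  qed
  show "ap u f \<in> Gr (n + 1)" if f: "f \<in> Gr n" for u f n
  proof -
    have "P (axp (P f)) \<in> Gr (n + 1)" "P (ayp (P f)) \<in> Gr (n + 1)"
      using decomposition_x decomposition_y
      by (intro lift_Gr is_operators f; simp add: quantum_decomposition_def)+
    then show ?thesis unfolding ap_def using subspace_Gr[of "n + 1"]
      by (simp add: subspace_add subspace_scale)
  qed
  show "X u f = am u f + a0 u f + ap u f" for u f by (rule X_decomposition)
  show "X u (X v f) = X v (X u f)" for u v f
  proof -
    have "X u (X v f) = P (form u * (form v * P f))" for u v
      unfolding X_def[of v] by (rule X_polys[OF form_mult_polys[OF P_polys]])
    then show ?thesis by (simp only: mult.left_commute)
  qed
  show "ip (X u f) g = ip f (X u g)" for u f g
  proof -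
    have "ip (X u f) g = ip (form u * P f) (P g)" for u f g by (simp add: ip_def X_def P_idem)
    then have "ip (X u f) g = (\<integral>z. form u z * P f z * P g z \<partial>\<mu>)" for u f g
      by (simp add: ip_polys form_mult_polys P_polys)
    then show ?thesis by (subst (2) ip_commute) (simp add: mult_ac)
  qed
  show "P f \<in> S" if "subspace S" "P 1 \<in> S" "\<And>u f. f \<in> S \<Longrightarrow> X u f \<in> S" for S f
    using that by (rule cyclic)
  show "\<exists>w w' w'' c. \<forall>f. A u (B v f) - B v (A u f) = am w f + a0 w' f + ap w'' f + c *\<^sub>R P f"
    if "A \<in> {am, a0, ap}" "B \<in> {am, a0, ap}" for A B u v
    using that by (rule closed_lifted)
  show "ip (X u (P 1)) (P 1) = 0" for u
  proof -
    have "ip (X u (P 1)) (P 1) = ip (form u * 1) 1" by (simp add: X_polys[OF polys_1] ip_def P_idem)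
    then show ?thesis
      using ip_polys[OF form_mult_polys[OF polys_1] polys_1, of u] expectation_form[of u] by simp
  qed
  show "u = 0" if "ip (X u (P 1)) (X u (P 1)) = 0" for u using that by (rule nondegenerate)
qed

sublocale fock: fock P ip "P 1" Gr am a0 ap X
  by (rule fock)

end

section \<open>Decomposition into a product\<close>

locale diagonal_plane = meixner_plane +
  fixes e1 e2 :: "real \<times> real"
  assumes diagonal: "diagonal_fock P ip (P 1) Gr am a0 ap X e1 e2"
begin

sublocale diagonal: diagonal_fock P ip "P 1" Gr am a0 ap X e1 e2
  by (rule diagonal)

lemma diagonal_plane_swap: "diagonal_plane \<mu> axm ax0 axp aym ay0 ayp e2 e1"
  by (intro diagonal_plane.intro diagonal_plane_axioms.intro meixner_plane_axioms
      diagonal.diagonal_fock_swap)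

lemma poly_form_polys: "(\<lambda>z. poly q (form u z)) \<in> polys"
proof (induction q)
  case 0
  then show ?case using polys_0 by (simp add: zero_fun_def)
next
  case (pCons a q)
  have "(\<lambda>z. poly (pCons a q) (form u z)) = a *\<^sub>R 1 + form u * (\<lambda>z. poly q (form u z))"
    by (simp add: fun_eq_iff)
  then show ?case using pCons by (simp only: polys_add polys_scale polys_1 form_mult_polys)
qed

lemma power_form_polys: "(\<lambda>z. form u z ^ n) \<in> polys"
  using poly_form_polys[of "monom 1 n" u] by (simp add: poly_monom)

lemma ip_P: "f \<in> polys \<Longrightarrow> g \<in> polys \<Longrightarrow> ip (P f) (P g) = (\<integral>z. f z * g z \<partial>\<mu>)"
  using ip_polys[of f g] by (simp add: ip_def P_idem)

lemma X_power: "(X u ^^ n) (P 1) = P (\<lambda>z. form u z ^ n)"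
proof (induction n)
  case 0
  then show ?case by (simp add: one_fun_def)
next
  case (Suc n)
  have "form u * (\<lambda>z. form u z ^ n) = (\<lambda>z. form u z ^ Suc n)" by (simp add: fun_eq_iff)
  then show ?case using X_polys[OF power_form_polys[of u n], of u] Suc by simp
qed

lemma moments_factor:
  "expectation (\<lambda>z. form e1 z ^ m * form e2 z ^ n)
   = expectation (\<lambda>z. form e1 z ^ m) * expectation (\<lambda>z. form e2 z ^ n)"
  using diagonal.X_factor[of m n]
  by (simp add: X_power ip_P power_form_polys polys_1)

definition marginal :: "real measure" where
  "marginal = distr \<mu> borel (form e1)"

lemma form_measurable [measurable]: "form u \<in> borel_measurable \<mu>"
  using polys_measurable form_polys by blast

lemma sets_marginal: "sets marginal = sets borel"
  by (simp add: marginal_def)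

text \<open>The ladder consists of the classes of the Jacobi polynomials of \<open>form e1\<close>,
  as both obey the same recurrence with the same start. Orthogonality of the ladder thus becomes
  orthogonality of the polynomials under the marginal. The sum of absolute values in the constant
  dominates both parameter sequences.\<close>

lemma marginal_structure:
  obtains \<beta> where "jacobi_measure marginal diagonal.drift \<beta>"
    and "factorial_moments \<mu> (form e1) (2 * (1 + 2 * (\<bar>diagonal.drift\<bar> + \<bar>\<beta>\<bar> + \<bar>1 - \<beta>\<bar>)))"
proof -
  define \<alpha> where "\<alpha> = diagonal.drift"
  obtain \<beta> where \<beta>: "\<alpha> = 0 \<Longrightarrow> \<beta> = 0"
    and X_chain: "\<And>n. X e1 (diagonal.chain n) = diagonal.chain (Suc n) + (\<alpha> * real n) *\<^sub>R diagonal.chain n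
      + (real n * (1 + \<beta> * (real n - 1))) *\<^sub>R diagonal.chain (n - 1)"
    unfolding \<alpha>_def by (rule diagonal.X_chain) blast
  define w where "w n = \<beta> * (real n)\<^sup>2 + (1 - \<beta>) * real n" for n
  define p where "p = jacobi_poly (\<lambda>n. \<alpha> * real n) w"
  define g where "g n = (\<lambda>z. poly (p n) (form e1 z))" for n
  have g_polys: "g n \<in> polys" for n unfolding g_def by (rule poly_form_polys)
  have w: "real n * (1 + \<beta> * (real n - 1)) = w n" for n
    by (simp add: w_def power2_eq_square algebra_simps)
  have chain: "diagonal.chain n = P (g n)" for n
  proof (induction n rule: less_induct)
    case (less n)
    show ?case
    proof (cases n)
      case 0
      have "g 0 = 1" by (simp add: g_def p_def fun_eq_iff)
      then show ?thesis using 0 by (simp only: diagonal.chain_simps)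
    next
      case (Suc k)
      have "form e1 * g k = g (Suc k) + (\<alpha> * real k) *\<^sub>R g k + w k *\<^sub>R g (k - 1)"
      proof
        fix z
        have "(form e1 * g k) z = poly ([:0, 1:] * p k) (form e1 z)" by (simp add: g_def)
        also have "\<dots> = (g (Suc k) + (\<alpha> * real k) *\<^sub>R g k + w k *\<^sub>R g (k - 1)) z"
          unfolding p_def jacobi_poly_recurrence by (auto simp: g_def p_def w_def)
        finally show "(form e1 * g k) z = (g (Suc k) + (\<alpha> * real k) *\<^sub>R g k + w k *\<^sub>R g (k - 1)) z" .
      qed
      then have "X e1 (P (g k)) = P (g (Suc k)) + (\<alpha> * real k) *\<^sub>R P (g k) + w k *\<^sub>R P (g (k - 1))"
        using X_polys[OF g_polys, of e1 k] by (simp only: P_add P_scale)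
      moreover have "diagonal.chain k = P (g k)" "diagonal.chain (k - 1) = P (g (k - 1))"
        by (rule less, simp add: Suc)+
      ultimately have "P (g (Suc k)) = diagonal.chain (Suc k)"
        using X_chain[of k] unfolding w by simp
      then show ?thesis unfolding Suc by (rule sym)
    qed
  qed
  have orth: "expectation (\<lambda>z. g m z * g n z) = 0" if "m \<noteq> n" for m n
    using diagonal.chain_orthogonal[OF that] by (simp add: chain ip_P g_polys)
  have g0: "g 0 = (\<lambda>_. 1)" by (simp add: g_def p_def)
  have int: "integrable \<mu> (\<lambda>z. form e1 z ^ n)" for n
    using integrable_polys power_form_polys by blast
  interpret marginal: prob_space marginal
    unfolding marginal_def by (rule prob_space_distr) simp
  show thesis
  proof (rule that[of \<beta>])
    show "jacobi_measure marginal diagonal.drift \<beta>"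
    proof
      show "sets marginal = sets borel" by (rule sets_marginal)
      show "integrable marginal (\<lambda>x. x ^ n)" for n
        using int by (simp add: marginal_def integrable_distr_eq)
      show "diagonal.drift = 0 \<Longrightarrow> \<beta> = 0" using \<beta> by (simp add: \<alpha>_def)
      show "(\<integral>x. poly (jacobi_poly (\<lambda>n. diagonal.drift * real n) (\<lambda>n. \<beta> * (real n)\<^sup>2 + (1 - \<beta>) * real n) m) x *
          poly (jacobi_poly (\<lambda>n. diagonal.drift * real n) (\<lambda>n. \<beta> * (real n)\<^sup>2 + (1 - \<beta>) * real n) n) x \<partial>marginal) = 0"
        if "m \<noteq> n" for m n
        unfolding marginal_def
        using orth[OF that] unfolding g_def p_def w_def[abs_def] \<alpha>_def
        by (subst integral_distr)
          (auto intro!: borel_measurable_continuous_onI continuous_intros)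
    qed
    show "factorial_moments \<mu> (form e1) (2 * (1 + 2 * (\<bar>diagonal.drift\<bar> + \<bar>\<beta>\<bar> + \<bar>1 - \<beta>\<bar>)))"
      unfolding \<alpha>_def[symmetric]
    proof (rule factorial_moments_of_jacobi)
      show "prob_space \<mu>" by (rule prob_space_axioms)
      show "integrable \<mu> (\<lambda>z. form e1 z ^ n)" for n by (rule int)
      show "expectation (\<lambda>z. poly (jacobi_poly (\<lambda>n. \<alpha> * real n) w k) (form e1 z)) = 0" if "k > 0" for k
        using orth[of k 0] that by (simp add: g0) (simp add: g_def p_def)
      show "\<bar>\<alpha> * real n\<bar> \<le> (\<bar>\<alpha>\<bar> + \<bar>\<beta>\<bar> + \<bar>1 - \<beta>\<bar>) * (real n + 1)" for n
        unfolding abs_mult by (intro mult_mono) auto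
      show "\<bar>w n\<bar> \<le> (\<bar>\<alpha>\<bar> + \<bar>\<beta>\<bar> + \<bar>1 - \<beta>\<bar>) * (real n)\<^sup>2" for n
      proof -
        have n: "real n \<le> (real n)\<^sup>2" by (cases n) (auto simp: power2_eq_square)
        have "\<bar>w n\<bar> \<le> \<bar>\<beta>\<bar> * (real n)\<^sup>2 + \<bar>1 - \<beta>\<bar> * real n"
          unfolding w_def by (rule order_trans[OF abs_triangle_ineq]) (simp add: abs_mult)
        also have "\<dots> \<le> \<bar>\<beta>\<bar> * (real n)\<^sup>2 + \<bar>1 - \<beta>\<bar> * (real n)\<^sup>2"
          using n by (intro add_left_mono mult_left_mono) auto
        also have "\<dots> \<le> (\<bar>\<alpha>\<bar> + \<bar>\<beta>\<bar> + \<bar>1 - \<beta>\<bar>) * (real n)\<^sup>2"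
          by (simp add: algebra_simps)
        finally show ?thesis .
      qed
    qed simp
  qed
qed

lemma meixner_marginal: "meixner_ML marginal"
  by (rule marginal_structure) (rule jacobi_measure.meixner)

lemma direction_nonzero: "(fst e1)\<^sup>2 + (snd e1)\<^sup>2 > 0"
proof -
  have "e1 \<noteq> 0" using diagonal.cov_basis(1) diagonal.cov_0(1)[of e1] by (metis zero_neq_one)
  then show ?thesis by (simp add: sum_power2_gt_zero_iff prod_eq_iff)
qed

text \<open>If some polynomial had norm zero, \<open>form e1\<close> would take almost surely only
  its roots as values, and the measure would live on finitely many parallel lines.\<close>

lemma meixner_marginal_infinite:
  assumes "\<And>Ls :: (real \<times> real \<times> real) set. finite Ls \<Longrightarrow> \<forall>(a, b, c) \<in> Ls. a\<^sup>2 + b\<^sup>2 > 0 \<Longrightarrow>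
    \<not> supported_by \<mu> (\<Union>(a, b, c) \<in> Ls. line a b c)"
  shows "meixner_ML_infinite marginal"
proof -
  obtain \<beta> where "jacobi_measure marginal diagonal.drift \<beta>" by (rule marginal_structure)
  then interpret M: jacobi_measure marginal diagonal.drift \<beta>
    "jacobi_poly (\<lambda>n. diagonal.drift * real n) (\<lambda>n. \<beta> * (real n)\<^sup>2 + (1 - \<beta>) * real n)" .
  let ?p = "jacobi_poly (\<lambda>n. diagonal.drift * real n) (\<lambda>n. \<beta> * (real n)\<^sup>2 + (1 - \<beta>) * real n)"
  show ?thesis
  proof (rule M.meixner_infinite)
    fix n
    show "M.norm2 n \<noteq> 0"
    proof
      assume "M.norm2 n = 0"
      then have "AE x in marginal. poly (?p n) x = 0" by (simp only: M.norm2_eq_0_iff)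
      then have AE: "AE z in \<mu>. poly (?p n) (form e1 z) = 0"
        unfolding marginal_def using M.monic(3)[of n]
        by (subst (asm) AE_distr_iff)
          (auto intro: borel_closed finite_imp_closed poly_roots_finite)
      \<comment> \<open>The constant term of the line for a root \<open>r\<close> is
        \<open>mean e1 + r\<close>, since \<open>form e1\<close> is the linear form minus its
        mean.\<close>
      define Ls where "Ls = (\<lambda>r. (fst e1, snd e1, mean e1 + r)) ` {r. poly (?p n) r = 0}"
      have "finite Ls" unfolding Ls_def by (intro finite_imageI poly_roots_finite M.monic)
      moreover have "\<forall>(a, b, c) \<in> Ls. a\<^sup>2 + b\<^sup>2 > 0" using direction_nonzero by (auto simp: Ls_def)
      moreover have "supported_by \<mu> (\<Union>(a, b, c) \<in> Ls. line a b c)"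
        unfolding supported_by_def using AE
      proof eventually_elim
        case (elim z)
        have "(fst e1, snd e1, mean e1 + form e1 z) \<in> Ls" unfolding Ls_def using elim by blast
        moreover have "z \<in> line (fst e1) (snd e1) (mean e1 + form e1 z)"
          by (auto simp: line_def form_eq split: prod.split)
        ultimately show ?case by blast
      qed
      ultimately show False using assms by blast
    qed
  qed
qed

end

section \<open>The product law and the affine map\<close>

context diagonal_plane
begin

lemma product:
  "distr \<mu> borel (\<lambda>z. (form e1 z, form e2 z))
   = marginal \<Otimes>\<^sub>M diagonal_plane.marginal \<mu> e2"
proof -
  interpret swap: diagonal_plane \<mu> axm ax0 axp aym ay0 ayp e2 e1
    by (rule diagonal_plane_swap)
  obtain K where K: "factorial_moments \<mu> (form e1) K" by (rule marginal_structure)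
  obtain K' where K': "factorial_moments \<mu> (form e2) K'" by (rule swap.marginal_structure)
  show ?thesis
    unfolding marginal_def swap.marginal_def
  proof (rule product_of_moments[OF K K'])
    show "integrable \<mu> (\<lambda>z. form e1 z ^ m * form e2 z ^ n)" for m n
      by (rule integrable_mult_polys[OF power_form_polys power_form_polys])
  qed (simp_all add: moments_factor)
qed

text \<open>The two forms are the coordinates of \<open>T (z - c)\<close>, where \<open>c\<close> is
  the mean and \<open>T\<close> takes Euclidean inner products with \<open>e1\<close> and
  \<open>e2\<close>; the required map is the inverse of \<open>T\<close>. A vector orthogonal to
  both \<open>e1\<close> and \<open>e2\<close> is orthogonal to itself, because it is a combination
  of them.\<close>

lemma affine_change:
  obtains S :: "real \<times> real \<Rightarrow> real \<times> real" and c where "linear S" "bij S"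
    "\<And>B. B \<in> sets borel \<Longrightarrow>
       emeasure (distr \<mu> borel (\<lambda>z. (form e1 z, form e2 z))) B = emeasure \<mu> ((\<lambda>z. S z + c) ` B)"
proof -
  define T where "T z = (e1 \<bullet> z, e2 \<bullet> z)" for z
  define c where "c = (mean_x, mean_y)"
  have "linear T" unfolding T_def
    by (rule linearI) (simp_all add: inner_add_right)
  have "inj T"
    unfolding linear_injective_0[OF \<open>linear T\<close>]
  proof (intro allI impI)
    fix z assume "T z = 0"
    then have "e1 \<bullet> z = 0" "e2 \<bullet> z = 0" by (simp_all add: T_def zero_prod_def)
    then have "z \<bullet> z = 0"
      by (subst diagonal.expand[of z]) (simp add: inner_add_left)
    then show "z = 0" by simp
  qed
  then have "bij T" using linear_injective_imp_surjective[OF \<open>linear T\<close>] by (simp add: bij_def)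
  have form: "(form e1 z, form e2 z) = T (z - c)" for z
    by (simp add: T_def form_def c_def inner_prod_def)
  show thesis
  proof (rule that[of "inv T" c])
    show "bij (inv T)" using \<open>bij T\<close> by (rule bij_imp_bij_inv)
    show "linear (inv T)" using \<open>linear T\<close> \<open>bij T\<close> by (simp add: bij_def inj_linear_imp_inv_linear)
    fix B :: "(real \<times> real) set" assume B: "B \<in> sets borel"
    have "(\<lambda>z. inv T z + c) ` B = (\<lambda>z. (form e1 z, form e2 z)) -` B"
    proof (intro set_eqI iffI)
      fix z assume "z \<in> (\<lambda>z. inv T z + c) ` B"
      then obtain b where "b \<in> B" "z = inv T b + c" by blast
      then show "z \<in> (\<lambda>z. (form e1 z, form e2 z)) -` B"
        unfolding vimage_def form using surj_f_inv_f[of T b] \<open>bij T\<close> by (simp add: bij_def)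
    next
      fix z assume "z \<in> (\<lambda>z. (form e1 z, form e2 z)) -` B"
      then have "T (z - c) \<in> B" unfolding vimage_def form by simp
      moreover have "inv T (T (z - c)) + c = z" using \<open>inj T\<close> by simp
      ultimately show "z \<in> (\<lambda>z. inv T z + c) ` B" by (metis imageI)
    qed
    moreover have "space \<mu> = UNIV" using sets_eq_imp_space_eq[OF borel] by simp
    ultimately show "emeasure (distr \<mu> borel (\<lambda>z. (form e1 z, form e2 z))) B
        = emeasure \<mu> ((\<lambda>z. inv T z + c) ` B)"
      using B by (subst emeasure_distr) auto
  qed
qed

end

lemma (in meixner_plane) diagonal_plane_exists:
  obtains e1 e2 where "diagonal_plane \<mu> axm ax0 axp aym ay0 ayp e1 e2"
proof -
  obtain g h where "fock.orthonormal_basis g h"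
    by (rule fock.orthonormal_basis_exists[of "(1, 0)" "(0, 1)"])
      (auto simp: zero_prod_def)
  then obtain e1 e2 where e: "fock.orthonormal_basis e1 e2" "fock.cubic e1 e1 e2 = 0" "fock.cubic e1 e2 e2 = 0"
    by (rule fock.diagonal_basis_exists)
  have "diagonal_fock P ip (P 1) Gr am a0 ap X e1 e2"
    by (intro diagonal_fock.intro diagonal_fock_axioms.intro fock e)
  then show thesis
    by (intro that[of e1 e2] diagonal_plane.intro diagonal_plane_axioms.intro meixner_plane_axioms)
qed

theorem corollary4p7:
  fixes \<mu> :: "(real \<times> real) measure"
  assumes "meixner_ML_plane \<mu>"
    and "\<forall>a b c. a\<^sup>2 + b\<^sup>2 > 0 \<longrightarrow> \<not> supported_by \<mu> (line a b c)"
  shows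
    "(\<exists>(S :: real \<times> real \<Rightarrow> real \<times> real) c \<nu> \<mu>1 \<mu>2.
        linear S \<and> bij S \<and> meixner_ML \<mu>1 \<and> meixner_ML \<mu>2 \<and>
        sets \<nu> = sets borel \<and>
        (\<forall>B \<in> sets borel. emeasure \<nu> B = emeasure \<mu> ((\<lambda>z. S z + c) ` B)) \<and>
        \<nu> = \<mu>1 \<Otimes>\<^sub>M \<mu>2)
     \<and>
     ((\<forall>Ls :: (real \<times> real \<times> real) set.
          finite Ls \<and> (\<forall>(a, b, c) \<in> Ls. a\<^sup>2 + b\<^sup>2 > 0) \<longrightarrow>
          \<not> supported_by \<mu> (\<Union>(a, b, c) \<in> Ls. line a b c)) \<longrightarrow>
      (\<exists>(S :: real \<times> real \<Rightarrow> real \<times> real) c \<nu> \<mu>1 \<mu>2.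
        linear S \<and> bij S \<and> meixner_ML_infinite \<mu>1 \<and> meixner_ML_infinite \<mu>2 \<and>
        sets \<nu> = sets borel \<and>
        (\<forall>B \<in> sets borel. emeasure \<nu> B = emeasure \<mu> ((\<lambda>z. S z + c) ` B)) \<and>
        \<nu> = \<mu>1 \<Otimes>\<^sub>M \<mu>2))"
proof -
  obtain axm ax0 axp aym ay0 ayp where
    "quantum_decomposition \<mu> mult_x axm ax0 axp" "quantum_decomposition \<mu> mult_y aym ay0 ayp"
    "\<forall>A \<in> op_span [axm, ax0, axp, aym, ay0, ayp, \<lambda>f. f].
     \<forall>B \<in> op_span [axm, ax0, axp, aym, ay0, ayp, \<lambda>f. f].
     \<exists>C \<in> op_span [axm, ax0, axp, aym, ay0, ayp, \<lambda>f. f]. op_eq \<mu> (commutator A B) C"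
    using assms(1) unfolding meixner_ML_plane_def Let_def by blast
  then interpret meixner_plane \<mu> axm ax0 axp aym ay0 ayp
    using assms unfolding meixner_plane_def meixner_plane_axioms_def plane_measure_def
      plane_measure_axioms_def meixner_ML_plane_def by blast
  obtain e1 e2 where "diagonal_plane \<mu> axm ax0 axp aym ay0 ayp e1 e2"
    by (rule diagonal_plane_exists)
  then interpret diagonal_plane \<mu> axm ax0 axp aym ay0 ayp e1 e2 .
  interpret swap: diagonal_plane \<mu> axm ax0 axp aym ay0 ayp e2 e1
    by (rule diagonal_plane_swap)
  obtain S c where S: "linear S" "bij S" "\<And>B. B \<in> sets borel \<Longrightarrow>
      emeasure (marginal \<Otimes>\<^sub>M swap.marginal) B = emeasure \<mu> ((\<lambda>z. S z + c) ` B)"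
    using affine_change unfolding product by blast
  have sets: "sets (marginal \<Otimes>\<^sub>M swap.marginal) = sets borel"
    unfolding product[symmetric] by simp
  show ?thesis
  proof (intro conjI impI)
    show "\<exists>S c \<nu> \<mu>1 \<mu>2. linear S \<and> bij S \<and> meixner_ML \<mu>1 \<and> meixner_ML \<mu>2 \<and>
        sets \<nu> = sets borel \<and>
        (\<forall>B \<in> sets borel. emeasure \<nu> B = emeasure \<mu> ((\<lambda>z. S z + c) ` B)) \<and> \<nu> = \<mu>1 \<Otimes>\<^sub>M \<mu>2"
      using S sets meixner_marginal swap.meixner_marginal by blast
    assume "\<forall>Ls :: (real \<times> real \<times> real) set.
          finite Ls \<and> (\<forall>(a, b, c) \<in> Ls. a\<^sup>2 + b\<^sup>2 > 0) \<longrightarrow>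
          \<not> supported_by \<mu> (\<Union>(a, b, c) \<in> Ls. line a b c)"
    then have "meixner_ML_infinite marginal" "meixner_ML_infinite swap.marginal"
      using meixner_marginal_infinite swap.meixner_marginal_infinite by blast+
    then show "\<exists>S c \<nu> \<mu>1 \<mu>2. linear S \<and> bij S \<and> meixner_ML_infinite \<mu>1 \<and> meixner_ML_infinite \<mu>2 \<and>
        sets \<nu> = sets borel \<and>
        (\<forall>B \<in> sets borel. emeasure \<nu> B = emeasure \<mu> ((\<lambda>z. S z + c) ` B)) \<and> \<nu> = \<mu>1 \<Otimes>\<^sub>M \<mu>2"
      using S sets by blast
  qed
qed

end
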